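(* Let $n,d,T\ge1$ be integers and let $p,q\in[1,\infty]$ be Hölder conjugates. Let $f_1,\dots,f_n:\mathbb{R}^d\to\mathbb{R}$ be continuously differentiable and let $L_q>0$ be such that $\|\nabla f_i(x)-\nabla f_i(y)\|_p\le L_q\|x-y\|_q$ for all $i\in\{1,\dots,n\}$ and $x,y\in\mathbb{R}^d$. Let $f=\frac1n\sum_{i=1}^nf_i$, and assume that $f$ is bounded below and that $x_*$ is a global minimizer of $f$ over $\mathbb{R}^d$. Fix $\mathsf P>0$ and set $$D=\mathsf P\sqrt{\frac{2}{L_qT}},\qquad \gamma=\frac1{d^{1/q}}\sqrt{\frac2{L_qT}}.$$ Let $\bar x_T$ be drawn uniformly at random from $\{x_1,\dots,x_T\}$ (uniform index in $\{1,\dots,T\}$, independent of everything else), where $(x_t)$ are the iterates of the algorithm SignSVRG (see context) run from $x_1\in\mathbb{R}^d$ with parameters $L_q,D,\gamma$. Then for Variant 1, $$\mathbb{E}[\|\nabla f(\bar x_T)\|_p]\le2\mathsf P\sqrt{\frac{2L_q}{T}}\quad\text{or}\quad\frac{\big(\mathbb{E}[\|\nabla f(\bar x_T)\|]\big)^2}{\mathbb{E}[\|\nabla f(\bar x_T)\|_p]}\le d^{1/q}\big(f(x_1)-f(x_* )+1\big)\sqrt{\frac{2L_q}{T}},$$ and for Variant 2, $$\mathbb{E}[\|\nabla f(\bar x_T)\|_1]\le\sqrt{\frac{2L_q}{T}}\,\max\Big(d^{1/q}\big(f(x_1)-f(x_* )+1\big),\;2d\,\mathsf P\Big).$$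
   Context: $\|\cdot\|$ is the Euclidean norm, $\|\cdot\|_r$ the $\ell_r$-norm on $\mathbb{R}^d$; $u^j$ is the $j$-th coordinate of $u$; $u\otimes v$ is the coordinate-wise product; $\mathrm{sign}$ acts coordinate-wise with $\mathrm{sign}(0)=0$; $1/\infty=0$. SignSVRG algorithm. Input: deterministic $x_1\in\mathbb{R}^d$, $L_q,D,\gamma>0$. Set $k(1)=1$, $\tilde x_1=x_1$ (initial reference point), $g_1=\nabla f(x_1)$. For $t=1,\dots,T$: 1. Sample $i_t$ uniformly on $\{1,\dots,n\}$ and $U_t$ uniformly on $[-1,1]^d$, independent of each other and of the past. 2. Define $G_t\in\mathbb{R}^d$ by, for every $j\in\{1,\dots,d\}$: Variant 1: $G_t^j=L_q\|x_t-\tilde x_{k(t)}\|_q+\|g_{k(t)}\|_p$ (the same value for all $j$); Variant 2: $G_t^j=L_q\|x_t-\tilde x_{k(t)}\|_q+|g_{k(t)}^j|$. 3. Set $x_t^+=x_t-\gamma\,\mathrm{sign}\big(\nabla f_{i_t}(x_t)-\nabla f_{i_t}(\tilde x_{k(t)})+g_{k(t)}+G_t\otimes U_t\big)$ and $x_{t+1}=x_t^+$. 4. If $\|x_t^+-\tilde x_{k(t)}\|_q\le D$, keep the reference point: $k(t+1)=k(t)$. Otherwise update it: $k(t+1)=k(t)+1$, $\tilde x_{k(t+1)}=x_t^+$, $g_{k(t+1)}=\nabla f(x_t^+)$. *)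

theory Defs
  imports "HOL-Probability.Probability"
begin

definition lr_norm :: "ereal \<Rightarrow> real ^ 'd \<Rightarrow> real" where
  "lr_norm r u =
     (if r = \<infinity> then infnorm u
      else (\<Sum>j\<in>UNIV. \<bar>u $ j\<bar> powr real_of_ereal r) powr (1 / real_of_ereal r))"

(* Only meaningful where f is differentiable. *)
definition grad :: "(real ^ 'd \<Rightarrow> real) \<Rightarrow> real ^ 'd \<Rightarrow> real ^ 'd" where
  "grad f x = (THE D. GDERIV f x :> D)"

definition continuously_differentiable :: "(real ^ 'd \<Rightarrow> real) \<Rightarrow> bool" where
  "continuously_differentiable f \<longleftrightarrow>
     (\<forall>x. f differentiable (at x)) \<and> continuous_on UNIV (grad f)"

(* The overloaded sgn on real ^ 'd is u / norm u, not the coordinate-wise sign. *)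
definition sign_vec :: "real ^ 'd \<Rightarrow> real ^ 'd" where
  "sign_vec u = (\<chi> j. sgn (u $ j))"

definition coord_mult :: "real ^ 'd \<Rightarrow> real ^ 'd \<Rightarrow> real ^ 'd" where
  "coord_mult u v = (\<chi> j. u $ j * v $ j)"

datatype variant = Variant1 | Variant2

(* In what follows r is the current reference point and g the full gradient at r. *)
definition smoothing_radius ::
  "variant \<Rightarrow> ereal \<Rightarrow> ereal \<Rightarrow> real \<Rightarrow> real ^ 'd \<Rightarrow> real ^ 'd \<Rightarrow> real ^ 'd \<Rightarrow> real ^ 'd" where
  "smoothing_radius v p q L x r g =
     (\<chi> j. L * lr_norm q (x - r) +
        (case v of Variant1 \<Rightarrow> lr_norm p g | Variant2 \<Rightarrow> \<bar>g $ j\<bar>))"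

definition signsvrg_step ::
  "variant \<Rightarrow> ereal \<Rightarrow> ereal \<Rightarrow> (real ^ 'd \<Rightarrow> real) \<Rightarrow> (nat \<Rightarrow> real ^ 'd \<Rightarrow> real) \<Rightarrow>
   real \<Rightarrow> real \<Rightarrow> real \<Rightarrow> nat \<Rightarrow> real ^ 'd \<Rightarrow>
   (real ^ 'd) \<times> (real ^ 'd) \<times> (real ^ 'd) \<Rightarrow> (real ^ 'd) \<times> (real ^ 'd) \<times> (real ^ 'd)" where
  "signsvrg_step v p q f fs L D \<gamma> i U = (\<lambda>(x, r, g).
     let G = smoothing_radius v p q L x r g;
         x' = x - \<gamma> *\<^sub>R sign_vec (grad (fs i) x - grad (fs i) r + g + coord_mult G U)
     in if lr_norm q (x' - r) \<le> D then (x', r, g) else (x', x', grad f x'))"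

(* State after m steps, i.e. (x_t, reference point at time t, its gradient) for t = m + 1.
   Of the sequence of reference points only the current one is ever read, so the
   counter k(t) need not be stored. *)
primrec signsvrg_state ::
  "variant \<Rightarrow> ereal \<Rightarrow> ereal \<Rightarrow> (real ^ 'd \<Rightarrow> real) \<Rightarrow> (nat \<Rightarrow> real ^ 'd \<Rightarrow> real) \<Rightarrow>
   real \<Rightarrow> real \<Rightarrow> real \<Rightarrow> real ^ 'd \<Rightarrow> (nat \<Rightarrow> nat) \<Rightarrow> (nat \<Rightarrow> real ^ 'd) \<Rightarrow>
   nat \<Rightarrow> (real ^ 'd) \<times> (real ^ 'd) \<times> (real ^ 'd)" where
  "signsvrg_state v p q f fs L D \<gamma> x1 i U 0 = (x1, x1, grad f x1)"
| "signsvrg_state v p q f fs L D \<gamma> x1 i U (Suc m) =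
     signsvrg_step v p q f fs L D \<gamma> (i (Suc m)) (U (Suc m))
       (signsvrg_state v p q f fs L D \<gamma> x1 i U m)"

(* The iterate x_t, for t \<ge> 1. *)
definition signsvrg_iterate ::
  "variant \<Rightarrow> ereal \<Rightarrow> ereal \<Rightarrow> (real ^ 'd \<Rightarrow> real) \<Rightarrow> (nat \<Rightarrow> real ^ 'd \<Rightarrow> real) \<Rightarrow>
   real \<Rightarrow> real \<Rightarrow> real \<Rightarrow> real ^ 'd \<Rightarrow> (nat \<Rightarrow> nat) \<Rightarrow> (nat \<Rightarrow> real ^ 'd) \<Rightarrow>
   nat \<Rightarrow> real ^ 'd" where
  "signsvrg_iterate v p q f fs L D \<gamma> x1 i U t =
     fst (signsvrg_state v p q f fs L D \<gamma> x1 i U (t - 1))"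

(* prob_space.indep_var only covers two random variables of the same type. *)
definition indep_rv ::
  "'s measure \<Rightarrow> 'a measure \<Rightarrow> ('s \<Rightarrow> 'a) \<Rightarrow> 'b measure \<Rightarrow> ('s \<Rightarrow> 'b) \<Rightarrow> bool" where
  "indep_rv M S X N Y \<longleftrightarrow>
     X \<in> measurable M S \<and> Y \<in> measurable M N \<and>
     prob_space.indep_set M {X -` A \<inter> space M | A. A \<in> sets S}
                            {Y -` B \<inter> space M | B. B \<in> sets N}"

(* The randomness of a run of length T with a uniformly drawn output index \<tau>:
   the pairs (i t, U t) are independent over t, within each pair i t and U t are independent,
   and \<tau> is independent of all of them. *)
definition signsvrg_sampling ::
  "'s measure \<Rightarrow> nat \<Rightarrow> nat \<Rightarrow> (nat \<Rightarrow> 's \<Rightarrow> nat) \<Rightarrow> (nat \<Rightarrow> 's \<Rightarrow> real ^ 'd) \<Rightarrow>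
   ('s \<Rightarrow> nat) \<Rightarrow> bool" where
  "signsvrg_sampling M n T i U \<tau> \<longleftrightarrow>
     prob_space M \<and>
     (\<forall>t\<in>{1..T}. distr M (count_space UNIV) (i t) = measure_pmf (pmf_of_set {1..n})) \<and>
     (\<forall>t\<in>{1..T}. distr M borel (U t) = uniform_measure lborel (cbox (\<chi> j. -1) (\<chi> j. 1))) \<and>
     distr M (count_space UNIV) \<tau> = measure_pmf (pmf_of_set {1..T}) \<and>
     (\<forall>t\<in>{1..T}. indep_rv M (count_space UNIV) (i t) borel (U t)) \<and>
     prob_space.indep_vars M (\<lambda>_. count_space UNIV \<Otimes>\<^sub>M borel)
       (\<lambda>t \<omega>. (i t \<omega>, U t \<omega>)) {1..T} \<and>
     indep_rv M (count_space UNIV) \<tau>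
       (PiM {1..T} (\<lambda>_. count_space UNIV \<Otimes>\<^sub>M borel))
       (\<lambda>\<omega>. \<lambda>t\<in>{1..T}. (i t \<omega>, U t \<omega>))"

end

theory Submission
  imports Defs
begin

text \<open>
  The estimate of each coordinate of the gradient is dominated by the smoothing radius, so the
  uniform noise makes the expected sign of the j-th coordinate equal to the j-th coordinate of the
  gradient divided by the radius. Combined with the descent lemma in the q-norm this bounds the
  average of the sum over j of the squared j-th partial derivative divided by the radius. Since the iterate stays within D of the
  reference point, the radius exceeds the p-norm of the current gradient (or the modulus of its
  coordinate) by at most 2 L D, and a Cauchy-Schwarz argument concludes.
  Each iterate takes only finitely many values, because the noise enters through signs only; hence
  integrability is automatic, and conditioning on the past is a finite sum.
\<close>

section \<open>The norms and the descent lemma\<close>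

text \<open>The radius is pulled in two directions. It must dominate every sampled estimate, since
  otherwise the expected sign is no longer linear in the estimate; but it also divides the progress
  of a step. The restart rule reconciles the two: one \<open>L * D\<close> pays for the drift from
  the reference point, another for replacing the reference gradient by the current one. After
  averaging, the denominator of the progress bound is a constant term plus a mean gradient norm b.
  This creates the two alternatives in Variant 1 and the maximum in Variant 2: either b is at most
  the constant term, or the denominator is at most \<open>2 * b\<close>, at the price of a factor 2.
  The radius may vanish along a run. The gradient coordinate it dominates vanishes with it, so the
  quotients stay correct under the convention that division by zero gives zero.\<close>

lemma lr_norm_real: "lr_norm (ereal s) u = (\<Sum>j\<in>UNIV. \<bar>u $ j\<bar> powr s) powr (1 / s)"
  by (simp add: lr_norm_def)

lemma lr_norm_infinity: "lr_norm \<infinity> u = infnorm u"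
  by (simp add: lr_norm_def)

lemma lr_norm_one: "lr_norm 1 u = (\<Sum>j\<in>UNIV. \<bar>u $ j\<bar>)"
  by (simp add: lr_norm_def sum_nonneg)

lemma infnorm_le_iff_cart: "infnorm (u :: real ^ 'd) \<le> c \<longleftrightarrow> (\<forall>j. \<bar>u $ j\<bar> \<le> c)"
proof
  assume "infnorm u \<le> c"
  then show "\<forall>j. \<bar>u $ j\<bar> \<le> c"
    using component_le_infnorm_cart[of u] order_trans by blast
next
  assume "\<forall>j. \<bar>u $ j\<bar> \<le> c"
  then show "infnorm u \<le> c"
    unfolding infnorm_cart by (intro cSup_least) auto
qed

lemma exponent_cases:
  assumes "1 \<le> (r :: ereal)"
  obtains "r = \<infinity>" | s where "r = ereal s" "1 \<le> s"
  using assms by (cases r) auto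

lemma lr_norm_nonneg: "0 \<le> lr_norm r u"
  by (simp add: lr_norm_def infnorm_pos_le)

lemma lr_norm_powr:
  assumes "1 \<le> s"
  shows "lr_norm (ereal s) u powr s = (\<Sum>j\<in>UNIV. \<bar>u $ j\<bar> powr s)"
  using assms by (simp add: lr_norm_real powr_powr sum_nonneg)

lemma lr_norm_le_iff:
  assumes "1 \<le> s" "0 \<le> c"
  shows "lr_norm (ereal s) u \<le> c \<longleftrightarrow> (\<Sum>j\<in>UNIV. \<bar>u $ j\<bar> powr s) \<le> c powr s"
proof
  assume "lr_norm (ereal s) u \<le> c"
  then have "lr_norm (ereal s) u powr s \<le> c powr s"
    using assms by (intro powr_mono2) (auto simp: lr_norm_nonneg)
  then show "(\<Sum>j\<in>UNIV. \<bar>u $ j\<bar> powr s) \<le> c powr s"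
    using assms by (simp add: lr_norm_powr)
next
  assume "(\<Sum>j\<in>UNIV. \<bar>u $ j\<bar> powr s) \<le> c powr s"
  then have "(\<Sum>j\<in>UNIV. \<bar>u $ j\<bar> powr s) powr (1 / s) \<le> (c powr s) powr (1 / s)"
    using assms by (intro powr_mono2) (auto simp: sum_nonneg)
  then show "lr_norm (ereal s) u \<le> c"
    using assms by (simp add: lr_norm_real powr_powr)
qed

lemma abs_component_le_lr_norm:
  assumes "1 \<le> r"
  shows "\<bar>u $ j\<bar> \<le> lr_norm r u"
  using assms
proof (cases r rule: exponent_cases)
  case 1
  then show ?thesis by (simp add: lr_norm_infinity component_le_infnorm_cart)
next
  case (2 s)
  have "\<bar>u $ j\<bar> powr s \<le> (\<Sum>j\<in>UNIV. \<bar>u $ j\<bar> powr s)"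
    by (rule member_le_sum) auto
  then have "(\<bar>u $ j\<bar> powr s) powr (1 / s) \<le> (\<Sum>j\<in>UNIV. \<bar>u $ j\<bar> powr s) powr (1 / s)"
    using 2 by (intro powr_mono2) auto
  then show ?thesis using 2 by (simp add: lr_norm_real powr_powr)
qed

lemma lr_norm_eq_0_iff:
  assumes "1 \<le> r"
  shows "lr_norm r u = 0 \<longleftrightarrow> u = 0"
proof
  assume "lr_norm r u = 0"
  then show "u = 0"
    using abs_component_le_lr_norm[OF assms, of u] by (simp add: vec_eq_iff)
next
  assume "u = 0"
  then show "lr_norm r u = 0"
    by (simp add: lr_norm_def infnorm_0)
qed

lemma lr_norm_scaleR:
  assumes "1 \<le> r"
  shows "lr_norm r (a *\<^sub>R u) = \<bar>a\<bar> * lr_norm r u"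
  using assms
proof (cases r rule: exponent_cases)
  case 1
  then show ?thesis by (simp add: lr_norm_infinity infnorm_mul)
next
  case (2 s)
  then show ?thesis
    by (simp add: lr_norm_real abs_mult powr_mult sum_nonneg powr_powr flip: sum_distrib_left)
qed

lemma lr_norm_sign_vec_le:
  fixes u :: "real ^ 'd"
  assumes "1 \<le> r"
  shows "lr_norm r (sign_vec u) \<le> real CARD('d) powr real_of_ereal (1 / r)"
  using assms
proof (cases r rule: exponent_cases)
  case 1
  then show ?thesis by (simp add: lr_norm_infinity infnorm_le_iff_cart sign_vec_def abs_sgn_eq)
next
  case (2 s)
  have "(\<Sum>j\<in>UNIV. \<bar>sign_vec u $ j\<bar> powr s) \<le> (\<Sum>j::'d\<in>UNIV. 1)"
    by (rule sum_mono) (simp add: sign_vec_def abs_sgn_eq)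
  then have "lr_norm r (sign_vec u) \<le> real CARD('d) powr (1 / s)"
    unfolding 2 lr_norm_real using 2 by (intro powr_mono2) (auto simp: sum_nonneg)
  then show ?thesis using 2 by (simp add: one_ereal_def)
qed

text \<open>For positive arguments this is convexity of the power function. If one argument is 0, it
  reduces to \<open>c powr s \<le> c\<close> for a weight c in [0, 1], which is the purpose of
  \<open>scale\<close>.\<close>

lemma powr_convex_nonneg:
  fixes x y a b s :: real
  assumes "1 \<le> s" "0 \<le> x" "0 \<le> y" "0 \<le> a" "0 \<le> b" "a + b = 1"
  shows "(a * x + b * y) powr s \<le> a * x powr s + b * y powr s"
proof -
  have scale: "(c * z) powr s \<le> c * z powr s" if "0 \<le> c" "c \<le> 1" "0 \<le> z" for c z :: real
  proof -
    have "c powr s \<le> c"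
      using powr_mono'[of 1 s c] that assms(1) by simp
    then show ?thesis
      using that by (simp add: powr_mult mult_right_mono)
  qed
  consider "x = 0" | "y = 0" | "0 < x" "0 < y" using assms by linarith
  then show ?thesis
  proof cases
    case 3
    then show ?thesis
      using convex_onD[OF powr_convex[OF assms(1)], of b x y] assms
      by (simp add: eq_diff_eq[THEN iffD2, OF assms(6)])
  qed (use scale[of b y] scale[of a x] assms in auto)
qed

text \<open>Minkowski by normalisation: each coordinate of \<open>u + v\<close>, divided by
  \<open>A + B\<close>, is at most a convex combination of the coordinates of u over
  \<open>A\<close> and of v over \<open>B\<close>, and the s-th powers of the latter sum to 1. Zero
  vectors are split off because \<open>A\<close> and \<open>B\<close> divide.\<close>

lemma lr_norm_triangle:
  assumes "1 \<le> r"
  shows "lr_norm r (u + v) \<le> lr_norm r u + lr_norm r v"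
  using assms
proof (cases r rule: exponent_cases)
  case 1
  then show ?thesis by (simp add: lr_norm_infinity infnorm_triangle)
next
  case (2 s)
  define A B where "A = lr_norm r u" and "B = lr_norm r v"
  consider "u = 0" | "v = 0" | "u \<noteq> 0" "v \<noteq> 0" by blast
  then show ?thesis
  proof cases
    case 3
    have pos: "0 < A" "0 < B"
      using 3 lr_norm_eq_0_iff[OF assms] lr_norm_nonneg[of r] by (auto simp: A_def B_def less_le)
    let ?a = "A / (A + B)" and ?b = "B / (A + B)"
    have "\<bar>(u + v) $ j\<bar> powr s
        \<le> (A + B) powr s * (?a * (\<bar>u $ j\<bar> / A) powr s + ?b * (\<bar>v $ j\<bar> / B) powr s)" for j
    proof -
      have "\<bar>(u + v) $ j\<bar> \<le> (A + B) * (?a * (\<bar>u $ j\<bar> / A) + ?b * (\<bar>v $ j\<bar> / B))"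
      proof -
        have "?a * (\<bar>u $ j\<bar> / A) + ?b * (\<bar>v $ j\<bar> / B) = (\<bar>u $ j\<bar> + \<bar>v $ j\<bar>) / (A + B)"
          using pos by (simp add: add_divide_distrib)
        then show ?thesis using pos by (simp add: abs_triangle_ineq)
      qed
      then have "\<bar>(u + v) $ j\<bar> powr s
          \<le> ((A + B) * (?a * (\<bar>u $ j\<bar> / A) + ?b * (\<bar>v $ j\<bar> / B))) powr s"
        using 2 by (intro powr_mono2) auto
      also have "\<dots> = (A + B) powr s * (?a * (\<bar>u $ j\<bar> / A) + ?b * (\<bar>v $ j\<bar> / B)) powr s"
        using pos by (subst powr_mult) auto
      also have "\<dots> \<le> (A + B) powr s * (?a * (\<bar>u $ j\<bar> / A) powr s + ?b * (\<bar>v $ j\<bar> / B) powr s)"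
        using pos 2 by (intro mult_left_mono powr_convex_nonneg)
          (auto simp flip: add_divide_distrib)
      finally show ?thesis .
    qed
    then have "(\<Sum>j\<in>UNIV. \<bar>(u + v) $ j\<bar> powr s)
        \<le> (\<Sum>j\<in>UNIV. (A + B) powr s * (?a * (\<bar>u $ j\<bar> / A) powr s + ?b * (\<bar>v $ j\<bar> / B) powr s))"
      by (rule sum_mono)
    also have "\<dots> = (A + B) powr s * (?a * ((\<Sum>j\<in>UNIV. \<bar>u $ j\<bar> powr s) / A powr s)
        + ?b * ((\<Sum>j\<in>UNIV. \<bar>v $ j\<bar> powr s) / B powr s))"
      using pos by (simp add: sum.distrib powr_divide distrib_left
          flip: sum_distrib_left sum_divide_distrib times_divide_eq_right)
    also have "\<dots> = (A + B) powr s"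
      using pos 2 by (simp add: A_def B_def flip: lr_norm_powr add_divide_distrib)
    finally show ?thesis
      using pos 2 lr_norm_le_iff[of s "A + B" "u + v"] by (simp add: A_def B_def)
  qed (auto simp: lr_norm_nonneg)
qed

lemma lr_norm_sum:
  assumes "1 \<le> r"
  shows "lr_norm r (\<Sum>l\<in>I. u l) \<le> (\<Sum>l\<in>I. lr_norm r (u l))"
proof (induction I rule: infinite_finite_induct)
  case (insert l I)
  then show ?case using lr_norm_triangle[OF assms, of "u l" "\<Sum>l\<in>I. u l"] by simp
qed (simp_all add: lr_norm_eq_0_iff[OF assms, THEN iffD2])

lemma lr_norm_minus_commute:
  assumes "1 \<le> r"
  shows "lr_norm r (u - v) = lr_norm r (v - u)"
  using lr_norm_scaleR[OF assms, of "-1" "u - v"] by simp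

lemma Holder_inequality_1_infinity:
  "\<bar>u \<bullet> v\<bar> \<le> lr_norm 1 u * lr_norm \<infinity> v"
proof -
  have "\<bar>u \<bullet> v\<bar> \<le> (\<Sum>j\<in>UNIV. \<bar>u $ j\<bar> * \<bar>v $ j\<bar>)"
    unfolding inner_vec_def by (simp flip: abs_mult)
  also have "\<dots> \<le> (\<Sum>j\<in>UNIV. \<bar>u $ j\<bar> * infnorm v)"
    by (intro sum_mono mult_left_mono component_le_infnorm_cart) auto
  finally show ?thesis by (simp add: lr_norm_one lr_norm_infinity sum_distrib_right)
qed

text \<open>Young's inequality is applied to the vectors scaled to norm 1, so that the coordinate
  sum collapses to \<open>1 / a + 1 / b\<close>.\<close>

lemma Holder_inequality_real:
  assumes "1 < a" "1 < b" "1 / a + 1 / b = 1"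
  shows "\<bar>u \<bullet> v\<bar> \<le> lr_norm (ereal a) u * lr_norm (ereal b) v"
proof (cases "u = 0 \<or> v = 0")
  case True
  then show ?thesis by (auto simp: lr_norm_nonneg)
next
  case False
  define A B where "A = lr_norm (ereal a) u" and "B = lr_norm (ereal b) v"
  have pos: "0 < A" "0 < B"
    using False assms lr_norm_nonneg[of "ereal a" u] lr_norm_nonneg[of "ereal b" v]
      lr_norm_eq_0_iff[of "ereal a" u] lr_norm_eq_0_iff[of "ereal b" v]
    by (auto simp: A_def B_def less_le)
  have "\<bar>u \<bullet> v\<bar> \<le> (\<Sum>j\<in>UNIV. \<bar>u $ j\<bar> * \<bar>v $ j\<bar>)"
    unfolding inner_vec_def by (simp flip: abs_mult)
  also have "\<dots> = A * B * (\<Sum>j\<in>UNIV. (\<bar>u $ j\<bar> / A) * (\<bar>v $ j\<bar> / B))"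
    using pos by (simp add: sum_distrib_left)
  also have "\<dots> \<le> A * B * (\<Sum>j\<in>UNIV. (\<bar>u $ j\<bar> / A) powr a / a + (\<bar>v $ j\<bar> / B) powr b / b)"
    using pos assms by (intro mult_left_mono sum_mono Youngs_inequality) auto
  also have "(\<Sum>j\<in>UNIV. (\<bar>u $ j\<bar> / A) powr a / a + (\<bar>v $ j\<bar> / B) powr b / b)
      = (\<Sum>j\<in>UNIV. \<bar>u $ j\<bar> powr a) / A powr a / a + (\<Sum>j\<in>UNIV. \<bar>v $ j\<bar> powr b) / B powr b / b"
    using pos by (simp add: sum.distrib powr_divide sum_divide_distrib)
  also have "\<dots> = 1"
    using pos assms by (simp add: A_def B_def flip: lr_norm_powr)
  finally show ?thesis by (simp add: A_def B_def)
qed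

lemma Holder_inequality:
  assumes "1 \<le> p" "1 \<le> q" "1 / p + 1 / q = 1"
  shows "\<bar>u \<bullet> v\<bar> \<le> lr_norm p u * lr_norm q v"
  using assms(1)
proof (cases p rule: exponent_cases)
  case 1
  then have "q = 1" using assms by (cases q) (auto simp: one_ereal_def divide_ereal_def split: if_splits)
  then show ?thesis
    using 1 Holder_inequality_1_infinity[of v u] by (simp add: inner_commute mult.commute)
next
  case p: (2 a)
  from assms(2) show ?thesis
  proof (cases q rule: exponent_cases)
    case 1
    then have "p = 1" using assms p by (auto simp: one_ereal_def)
    then show ?thesis using 1 Holder_inequality_1_infinity[of u v] by simp
  next
    case q: (2 b)
    have eq: "1 / a + 1 / b = 1"
      using assms(3) p q by (simp add: one_ereal_def)
    then have "1 < a" "1 < b"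
      using p q by (auto simp: less_le)
    then show ?thesis unfolding p q using eq by (rule Holder_inequality_real)
  qed
qed

section \<open>Gradients and the descent lemma\<close>

lemma GDERIV_grad:
  fixes f :: "real ^ 'd \<Rightarrow> real"
  assumes "f differentiable (at x)"
  shows "GDERIV f x :> grad f x"
proof -
  obtain F where F: "(f has_derivative F) (at x)"
    using assms by (auto simp: differentiable_def)
  then have "linear F" by (rule has_derivative_linear)
  \<comment> \<open>Riesz representation in the standard basis. It gives existence for the definite
    description in \<open>grad\<close>; uniqueness follows from that of the derivative.\<close>
  then have "F = (\<lambda>h. h \<bullet> (\<Sum>b\<in>Basis. F b *\<^sub>R b))"
    by (auto simp: fun_eq_iff inner_sum_right mult.commute
        intro: Linear_Algebra.linear_componentwise[where j = "1 :: real", simplified])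
  then have ex: "GDERIV f x :> (\<Sum>b\<in>Basis. F b *\<^sub>R b)"
    using F by (simp add: gderiv_def)
  have uniq: "D = D'" if "GDERIV f x :> D" "GDERIV f x :> D'" for D D'
    using has_derivative_unique[OF that[unfolded gderiv_def]]
    by (metis vector_eq_ldot)
  show ?thesis
    unfolding grad_def by (rule theI[where a = "\<Sum>b\<in>Basis. F b *\<^sub>R b"]) (use ex uniq in auto)
qed

lemma grad_eqI:
  fixes f :: "real ^ 'd \<Rightarrow> real"
  assumes "GDERIV f x :> D"
  shows "grad f x = D"
proof -
  have "f differentiable (at x)"
    using assms by (auto simp: gderiv_def differentiable_def)
  from GDERIV_grad[OF this] assms show ?thesis
    using has_derivative_unique unfolding gderiv_def by (metis vector_eq_ldot)
qed

lemma GDERIV_average: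
  fixes fs :: "nat \<Rightarrow> real ^ 'd \<Rightarrow> real"
  assumes "\<And>l. l \<in> I \<Longrightarrow> fs l differentiable (at x)"
  shows "GDERIV (\<lambda>x. c * (\<Sum>l\<in>I. fs l x)) x :> c *\<^sub>R (\<Sum>l\<in>I. grad (fs l) x)"
proof -
  have "((\<lambda>x. c * (\<Sum>l\<in>I. fs l x)) has_derivative (\<lambda>h. c * (\<Sum>l\<in>I. h \<bullet> grad (fs l) x))) (at x)"
    using GDERIV_grad[OF assms] unfolding gderiv_def
    by (intro has_derivative_mult_right has_derivative_sum)
  then show ?thesis by (simp add: gderiv_def inner_sum_right)
qed

text \<open>Along the segment, \<open>\<phi>\<close> is the function minus the claimed bound without
  its constant \<open>f x\<close>. Hoelder and the Lipschitz condition make its derivative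
  nonpositive, and \<open>\<phi> 1 \<le> \<phi> 0\<close> is the claim; monotonicity takes the place
  of integrating the gradient.\<close>

lemma descent_lemma:
  fixes f :: "real ^ 'd \<Rightarrow> real"
  assumes pq: "1 \<le> p" "1 \<le> q" "1 / p + 1 / q = 1"
    and f: "\<And>x. f differentiable (at x)"
    and L: "0 \<le> L" "\<And>x y. lr_norm p (grad f x - grad f y) \<le> L * lr_norm q (x - y)"
  shows "f (x + h) \<le> f x + grad f x \<bullet> h + L / 2 * (lr_norm q h)\<^sup>2"
proof -
  define \<phi> where "\<phi> t = f (x + t *\<^sub>R h) - t * (grad f x \<bullet> h) - L / 2 * t\<^sup>2 * (lr_norm q h)\<^sup>2" for t
  define \<phi>' where "\<phi>' t = h \<bullet> grad f (x + t *\<^sub>R h) - grad f x \<bullet> h - L * t * (lr_norm q h)\<^sup>2" for t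
  have deriv: "(\<phi> has_real_derivative \<phi>' t) (at t)" for t
  proof -
    have "((\<lambda>t. x + t *\<^sub>R h) has_derivative (\<lambda>s. s *\<^sub>R h)) (at t)"
      by (auto intro!: derivative_eq_intros)
    from has_derivative_compose[OF this GDERIV_grad[OF f, unfolded gderiv_def]]
    have "((\<lambda>t. f (x + t *\<^sub>R h)) has_real_derivative h \<bullet> grad f (x + t *\<^sub>R h)) (at t)"
      by (simp add: has_field_derivative_def mult_commute_abs)
    moreover have "((\<lambda>t. t * (grad f x \<bullet> h)) has_real_derivative grad f x \<bullet> h) (at t)"
      "((\<lambda>t. L / 2 * t\<^sup>2 * (lr_norm q h)\<^sup>2) has_real_derivative L * t * (lr_norm q h)\<^sup>2) (at t)"
      by (auto intro!: derivative_eq_intros)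
    ultimately show ?thesis
      unfolding \<phi>_def[abs_def] \<phi>'_def by (intro DERIV_diff)
  qed
  have "\<phi>' t \<le> 0" if "0 \<le> t" for t
  proof -
    have "(grad f (x + t *\<^sub>R h) - grad f x) \<bullet> h
        \<le> lr_norm p (grad f (x + t *\<^sub>R h) - grad f x) * lr_norm q h"
      by (rule order_trans[OF abs_ge_self Holder_inequality[OF pq]])
    also have "\<dots> \<le> (L * lr_norm q (x + t *\<^sub>R h - x)) * lr_norm q h"
      by (intro mult_right_mono L lr_norm_nonneg)
    also have "\<dots> = L * t * (lr_norm q h)\<^sup>2"
      using that pq by (simp add: lr_norm_scaleR power2_eq_square)
    finally show ?thesis by (simp add: \<phi>'_def inner_diff_left inner_commute[of h])
  qed
  then have "\<phi> 1 \<le> \<phi> 0"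
    using deriv by (intro DERIV_nonpos_imp_nonincreasing[of 0 1 \<phi>]) (simp, blast)
  then show ?thesis by (simp add: \<phi>_def)
qed

section \<open>Uniform noise and independence\<close>

definition cube :: "(real ^ 'd) set" where
  "cube = cbox (\<chi> j. -1) (\<chi> j. 1)"

lemma prod_update_UNIV:
  fixes b c :: real and j :: "'d :: finite"
  shows "(\<Prod>k\<in>UNIV. if k = j then b else c) = b * c ^ (CARD('d) - 1)"
  by (simp add: prod.remove[of UNIV j] card_Diff_singleton)

lemma measure_cube: "measure lborel (cube :: (real ^ 'd) set) = 2 ^ CARD('d)"
proof -
  have "(cube :: (real ^ 'd) set) \<noteq> {}"
    by (auto simp: cube_def mem_box_cart interval_ne_empty_cart intro!: exI[of _ 0])
  then show ?thesis by (simp add: cube_def content_cbox_cart)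
qed

text \<open>A coordinate half-space cuts the cube in a box with one altered side, of length 1 + c or
  1 - c.\<close>

lemma measure_cube_component:
  fixes j :: "'d :: finite"
  assumes "-1 \<le> c" "c \<le> 1"
  shows "measure lborel (cube \<inter> {u :: real ^ 'd. u $ j \<le> c}) = (1 + c) * 2 ^ (CARD('d) - 1)"
    and "measure lborel (cube \<inter> {u :: real ^ 'd. c \<le> u $ j}) = (1 - c) * 2 ^ (CARD('d) - 1)"
proof -
  let ?lo = "(\<chi> k. if k = j then c else -1) :: real ^ 'd" and ?hi = "(\<chi> k. if k = j then c else 1) :: real ^ 'd"
  have "cube \<inter> {u. u $ j \<le> c} = cbox (\<chi> k. -1) ?hi"
    using assms by (auto simp: cube_def mem_box_cart) (smt (verit))+
  moreover have "cube \<inter> {u. c \<le> u $ j} = cbox ?lo (\<chi> k. 1)"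
    using assms by (auto simp: cube_def mem_box_cart) (smt (verit))+
  moreover have "?hi \<in> cbox (\<chi> k. -1) ?hi" "?lo \<in> cbox ?lo (\<chi> k. 1)"
    using assms by (auto simp: mem_box_cart)
  then have "cbox (\<chi> k. -1) ?hi \<noteq> {}" "cbox ?lo (\<chi> k. 1) \<noteq> {}" by blast+
  moreover have "(\<Prod>k\<in>UNIV. (if k = j then c else 1) - (- 1)) = (\<Prod>k\<in>UNIV. if k = j then 1 + c else 2)"
      "(\<Prod>k\<in>UNIV. 1 - (if k = j then c else - 1)) = (\<Prod>k\<in>UNIV. if k = j then 1 - c else 2)"
    by (auto intro!: prod.cong)
  ultimately show "measure lborel (cube \<inter> {u. u $ j \<le> c}) = (1 + c) * 2 ^ (CARD('d) - 1)"
    and "measure lborel (cube \<inter> {u. c \<le> u $ j}) = (1 - c) * 2 ^ (CARD('d) - 1)"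
    by (simp_all add: content_cbox_cart prod_update_UNIV)
qed

lemma emeasure_cube: "emeasure lborel (cube :: (real ^ 'd) set) = ennreal (2 ^ CARD('d))"
  unfolding measure_cube[symmetric] unfolding cube_def
  by (intro emeasure_eq_ennreal_measure) (metis emeasure_lborel_cbox_finite infinity_ennreal_def less_irrefl)

lemma measure_uniform_cube_component:
  fixes j :: "'d :: finite"
  assumes "-1 \<le> c" "c \<le> 1"
  shows "measure (uniform_measure lborel cube) {u :: real ^ 'd. u $ j \<le> c} = (1 + c) / 2"
    and "measure (uniform_measure lborel cube) {u :: real ^ 'd. c \<le> u $ j} = (1 - c) / 2"
  using measure_cube_component[OF assms, of j] power_Suc[of "2 :: real" "CARD('d) - 1"]
  by (simp_all add: measure_uniform_measure emeasure_cube measure_cube)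

lemma prob_space_uniform_cube: "prob_space (uniform_measure lborel (cube :: (real ^ 'd) set))"
  by (intro prob_space_uniform_measure) (simp_all add: emeasure_cube)

text \<open>The sign flips where the noise coordinate crosses \<open>- v / G\<close>. The hypothesis
  places this threshold in [-1, 1], where the uniform distribution function is affine, so the
  difference of the two tail probabilities is linear in v.\<close>

lemma integral_sgn_uniform_cube:
  fixes j :: "'d :: finite"
  assumes "\<bar>v\<bar> \<le> G"
  shows "(LINT u|uniform_measure lborel cube. sgn (v + G * (u :: real ^ 'd) $ j)) = v / G"
proof (cases "G = 0")
  \<comment> \<open>Then v = 0 as well, and \<open>v / 0 = 0\<close> agrees with the integral of
    \<open>sgn 0\<close>.\<close>
  case True
  then show ?thesis using assms by simp
next
  case False
  interpret prob_space "uniform_measure lborel (cube :: (real ^ 'd) set)"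
    by (rule prob_space_uniform_cube)
  have G: "0 < G" using assms False by linarith
  have meas [measurable]: "(\<lambda>u :: real ^ 'd. u $ j) \<in> borel_measurable borel"
    by (intro borel_measurable_continuous_onI continuous_intros)
  \<comment> \<open>Both half-spaces are closed: at the threshold the indicators cancel, in
    agreement with \<open>sgn 0 = 0\<close>, so no null set has to be discarded.\<close>
  have "sgn (v + G * u $ j) = indicator {u. - v / G \<le> u $ j} u - indicator {u. u $ j \<le> - v / G} u"
    for u :: "real ^ 'd"
    using G by (auto simp: sgn_if indicator_def field_simps)
  moreover have "integrable (uniform_measure lborel cube) (indicator {u :: real ^ 'd. - v / G \<le> u $ j} :: _ \<Rightarrow> real)"
    "integrable (uniform_measure lborel cube) (indicator {u :: real ^ 'd. u $ j \<le> - v / G} :: _ \<Rightarrow> real)"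
    by (auto intro!: integrable_const_bound[where B = 1])
  ultimately have "(LINT u|uniform_measure lborel cube. sgn (v + G * (u :: real ^ 'd) $ j))
      = prob {u. - v / G \<le> u $ j} - prob {u. u $ j \<le> - v / G}"
    by simp
  also have "\<dots> = v / G"
    proof -
    have "-1 \<le> - v / G" "- v / G \<le> 1" using G assms by (simp_all add: field_simps)
    then show ?thesis
      by (simp only: measure_uniform_cube_component) (simp add: field_simps)
  qed
  finally show ?thesis .
qed

text \<open>Passage from the two-type notion \<open>indep_rv\<close> to \<open>indep_var\<close>.
  Composing with g and h reaches a common type and only shrinks the families of preimages; these are
  stable under intersection, so independence extends to the generated sigma-algebras.\<close>

lemma indep_rv_imp_indep_var:
  assumes "prob_space M" "indep_rv M S X N Y"
    and g: "g \<in> measurable S K" and h: "h \<in> measurable N K'"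
  shows "prob_space.indep_var M K (\<lambda>\<omega>. g (X \<omega>)) K' (\<lambda>\<omega>. h (Y \<omega>))"
proof -
  interpret prob_space M by fact
  have X: "X \<in> measurable M S" and Y: "Y \<in> measurable M N"
    and ind: "indep_set {X -` A \<inter> space M | A. A \<in> sets S} {Y -` B \<inter> space M | B. B \<in> sets N}"
    using assms(2) by (auto simp: indep_rv_def)
  note [measurable] = X Y g h
  let ?P = "{(\<lambda>\<omega>. g (X \<omega>)) -` A \<inter> space M | A. A \<in> sets K}"
    and ?Q = "{(\<lambda>\<omega>. h (Y \<omega>)) -` A \<inter> space M | A. A \<in> sets K'}"
  have pull: "\<exists>B. (\<lambda>\<omega>. k (Z \<omega>)) -` A \<inter> space M = Z -` B \<inter> space M \<and> B \<in> sets R"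
    if "A \<in> sets Q" "k \<in> measurable R Q" "Z \<in> measurable M R" for k Z A R Q
    using that measurable_space[OF that(3)]
    by (intro exI[of _ "k -` A \<inter> space R"]) auto
  have "indep_set ?P ?Q"
    unfolding indep_set_def
    by (rule indep_sets_mono_sets[OF ind[unfolded indep_set_def]])
      (use pull[OF _ g X] pull[OF _ h Y] in \<open>auto split: bool.split\<close>)
  moreover have "Int_stable {Z -` A \<inter> space M | A. A \<in> sets R}" for Z R
  proof (rule Int_stableI, safe)
    fix A B assume "A \<in> sets R" "B \<in> sets R"
    then show "\<exists>C. Z -` A \<inter> space M \<inter> (Z -` B \<inter> space M) = Z -` C \<inter> space M \<and> C \<in> sets R"
      by (intro exI[of _ "A \<inter> B"]) auto
  qed
  ultimately show ?thesis
    unfolding indep_var_eq by (auto intro!: indep_set_sigma_sets)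
qed

lemma finite_range_sign_vec: "finite (range (sign_vec :: real ^ 'd \<Rightarrow> real ^ 'd))"
proof (rule finite_subset)
  show "range (sign_vec :: real ^ 'd \<Rightarrow> real ^ 'd)
      \<subseteq> (\<lambda>h. \<chi> j. h j) ` (PiE UNIV (\<lambda>_. {-1, 0, 1}))"
    unfolding sign_vec_def proof safe
    fix u :: "real ^ 'd"
    have "(\<lambda>j. sgn (u $ j)) \<in> PiE UNIV (\<lambda>_. {-1, 0, 1})"
      by (auto simp: sgn_if split: if_splits)
    then show "(\<chi> j. sgn (u $ j)) \<in> (\<lambda>h. \<chi> j. h j) ` (PiE UNIV (\<lambda>_. {-1, 0, 1}))"
      by (rule imageI)
  qed
qed (intro finite_imageI finite_PiE; simp)

text \<open>The target carries the discrete sigma-algebra although its type is uncountable;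
  finiteness of the range reduces the claim to preimages of single sign vectors. In return every
  function of a sign vector is measurable, including the state update with its calls to
  \<open>grad f\<close>.\<close>

lemma measurable_sign_vec:
  "(sign_vec :: real ^ 'd \<Rightarrow> real ^ 'd) \<in> measurable borel (count_space UNIV)"
proof -
  have "(sign_vec :: real ^ 'd \<Rightarrow> real ^ 'd) \<in> measurable borel (count_space (range sign_vec))"
  proof (subst measurable_count_space_eq2[OF finite_range_sign_vec], safe)
    fix w :: "real ^ 'd"
    have [measurable]: "(\<lambda>u :: real ^ 'd. u $ j) \<in> borel_measurable borel" for j
      by (intro borel_measurable_continuous_onI continuous_intros)
    have "sign_vec -` {sign_vec w} \<inter> space borel = {u \<in> space borel. \<forall>j\<in>UNIV. sgn (u $ j) = sgn (w $ j)}"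
      by (auto simp: sign_vec_def vec_eq_iff)
    also have "\<dots> \<in> sets borel" by measurable
    finally show "sign_vec -` {sign_vec w} \<inter> space borel \<in> sets borel" .
  qed auto
  from measurable_compose[OF this, of "\<lambda>\<sigma>. \<sigma>" "count_space UNIV"] show ?thesis by simp
qed

lemma measurable_sample_vec:
  fixes a :: "nat \<Rightarrow> real ^ 'd"
  shows "(\<lambda>z. a (fst z) + coord_mult G (snd z)) \<in> borel_measurable (count_space UNIV \<Otimes>\<^sub>M borel)"
proof -
  have [measurable]: "(\<lambda>u :: real ^ 'd. coord_mult G u) \<in> borel_measurable borel"
    unfolding coord_mult_def by (intro borel_measurable_continuous_onI continuous_intros)
  have [measurable]: "a \<in> borel_measurable (count_space UNIV)" by simp
  show ?thesis by measurable
qed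

section \<open>Runs of the algorithm\<close>

type_synonym 'd triple = "(real, 'd) vec \<times> (real, 'd) vec \<times> (real, 'd) vec"

locale signsvrg_run =
  fixes v :: variant and p q :: ereal
    and f :: "real ^ 'd \<Rightarrow> real" and fs :: "nat \<Rightarrow> real ^ 'd \<Rightarrow> real"
    and L D \<gamma> :: real and x1 :: "real ^ 'd"
begin

definition pos :: "'d triple \<Rightarrow> real ^ 'd" where
  "pos s = fst s"

definition ref :: "'d triple \<Rightarrow> real ^ 'd" where
  "ref s = fst (snd s)"

definition refgrad :: "'d triple \<Rightarrow> real ^ 'd" where
  "refgrad s = snd (snd s)"

definition radius :: "'d triple \<Rightarrow> real ^ 'd" where
  "radius s = smoothing_radius v p q L (pos s) (ref s) (refgrad s)"

definition estimate :: "'d triple \<Rightarrow> nat \<Rightarrow> real ^ 'd" where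
  "estimate s l = grad (fs l) (pos s) - grad (fs l) (ref s) + refgrad s"

definition direction ::
  "'d triple \<Rightarrow> nat \<times> (real ^ 'd) \<Rightarrow> real ^ 'd" where
  "direction s z = sign_vec (estimate s (fst z) + coord_mult (radius s) (snd z))"

text \<open>The sample enters a step only through \<open>direction\<close>; given the sign vector,
  the update is deterministic. Finiteness and measurability of the states rest on this
  factorisation.\<close>

definition advance ::
  "'d triple \<Rightarrow> real ^ 'd \<Rightarrow> 'd triple" where
  "advance s \<sigma> = (let x' = pos s - \<gamma> *\<^sub>R \<sigma>
     in if lr_norm q (x' - ref s) \<le> D then (x', ref s, refgrad s) else (x', x', grad f x'))"

text \<open>The random inputs are bundled into one path w, so that independence can be read off from
  the coordinates used: step m + 1 reads \<open>w (Suc m)\<close>, and \<open>w 0\<close> is never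
  read.\<close>

definition run ::
  "(nat \<Rightarrow> nat \<times> (real ^ 'd)) \<Rightarrow> nat \<Rightarrow> 'd triple" where
  "run w m = signsvrg_state v p q f fs L D \<gamma> x1 (\<lambda>t. fst (w t)) (\<lambda>t. snd (w t)) m"

lemma run_0: "run w 0 = (x1, x1, grad f x1)"
  by (simp add: run_def)

lemma run_Suc: "run w (Suc m) = advance (run w m) (direction (run w m) (w (Suc m)))"
  by (simp add: run_def signsvrg_step_def advance_def direction_def estimate_def radius_def
      pos_def ref_def refgrad_def Let_def split: prod.split)

lemma run_cong: "(\<And>t. t \<in> {1..m} \<Longrightarrow> w t = w' t) \<Longrightarrow> run w m = run w' m"
  by (induction m) (simp_all add: run_0 run_Suc)

lemma pos_advance: "pos (advance s \<sigma>) = pos s - \<gamma> *\<^sub>R \<sigma>"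
  by (simp add: advance_def pos_def Let_def)

lemma refgrad_run: "refgrad (run w m) = grad f (ref (run w m))"
  by (induction m) (auto simp: run_0 run_Suc advance_def Let_def ref_def refgrad_def)

text \<open>The reference point is replaced exactly when the distance would exceed \<open>D\<close>,
  and then the new distance is 0.\<close>

lemma lr_norm_pos_ref_run:
  assumes "1 \<le> q" "0 \<le> D"
  shows "lr_norm q (pos (run w m) - ref (run w m)) \<le> D"
proof -
  have "lr_norm q (0 :: real ^ 'd) = 0" using assms by (simp add: lr_norm_eq_0_iff)
  then show ?thesis
    using assms by (induction m)
      (simp_all add: run_0 run_Suc advance_def Let_def pos_def ref_def)
qed

lemma finite_range_run: "finite (range (\<lambda>w. run w m))"
proof (induction m)
  case (Suc m)
  have "range (\<lambda>w. run w (Suc m))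
      \<subseteq> (\<lambda>(s, \<sigma>). advance s \<sigma>) ` (range (\<lambda>w. run w m) \<times> range sign_vec)"
    by (force simp: run_Suc direction_def)
  then show ?case
    by (rule finite_subset) (intro finite_imageI finite_cartesian_product Suc finite_range_sign_vec)
qed (simp add: run_0)

lemma measurable_direction:
  "direction s \<in> measurable (count_space UNIV \<Otimes>\<^sub>M borel) (count_space UNIV)"
  unfolding direction_def[abs_def]
  by (rule measurable_compose[OF measurable_sample_vec measurable_sign_vec])

lemma measurable_run:
  assumes "{1..m} \<subseteq> I"
  shows "(\<lambda>w. run w m) \<in> measurable (PiM I (\<lambda>_. count_space UNIV \<Otimes>\<^sub>M borel)) (count_space UNIV)"
  using assms
proof (induction m)
  case (Suc m)
  then have IH: "(\<lambda>w. run w m) \<in> measurable (PiM I (\<lambda>_. count_space UNIV \<Otimes>\<^sub>M borel)) (count_space UNIV)"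
    and m: "Suc m \<in> I" by (auto simp: subset_iff)
  have "(\<lambda>w. advance s (direction s (w (Suc m))))
      \<in> measurable (PiM I (\<lambda>_. count_space UNIV \<Otimes>\<^sub>M borel)) (count_space UNIV)" for s
    by (rule measurable_compose[OF measurable_compose[OF measurable_component_singleton[OF m]
          measurable_direction]]) simp
  \<comment> \<open>Since the earlier state has finite range, one may split over its values; for
    each fixed value the next state depends on a single coordinate of the path.\<close>
  moreover have "(\<lambda>w. run w m) \<in> measurable (PiM I (\<lambda>_. count_space UNIV \<Otimes>\<^sub>M borel))
      (count_space (range (\<lambda>w. run w m)))"
    by (rule measurable_count_space_extend[OF subset_UNIV _ IH]) auto
  ultimately show ?case
    unfolding run_Suc
    by (rule measurable_compose_countable'[where f = "\<lambda>s w. advance s (direction s (w (Suc m)))"])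
      (rule countable_finite[OF finite_range_run])
qed (simp add: run_0)

end

text \<open>
  Tested against all c at once, this bound is linear in the numerator and the denominator; it takes
  the place of the Cauchy-Schwarz inequality for sums, expectations and averages alike.
\<close>
lemma quadratic_minorant:
  fixes a b c :: real
  assumes "0 \<le> b" "b = 0 \<Longrightarrow> a = 0"
  shows "2 * c * a - c\<^sup>2 * b \<le> a\<^sup>2 / b"
proof (cases "b = 0")
  case False
  have "0 \<le> (a - c * b)\<^sup>2 / b" using assms by simp
  also have "\<dots> = a\<^sup>2 / b - (2 * c * a - c\<^sup>2 * b)"
    using False by (simp add: power2_eq_square field_simps)
  finally show ?thesis by simp
qed (use assms in simp)

lemma square_le_if_quadratic_minorants:
  fixes a b k :: real
  assumes "0 < b" "\<And>c. 2 * c * a - c\<^sup>2 * b \<le> k"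
  shows "a\<^sup>2 \<le> k * b"
  \<comment> \<open>This c maximises the minorant, with value \<open>a\<^sup>2 / b\<close>.\<close>
  using assms(2)[of "a / b"] assms(1) by (simp add: power2_eq_square field_simps)

locale signsvrg = signsvrg_run v p q f fs L D \<gamma> x1 + prob_space M
  for v :: variant and p q :: ereal
    and f :: "real ^ 'd \<Rightarrow> real" and fs :: "nat \<Rightarrow> real ^ 'd \<Rightarrow> real"
    and L D \<gamma> :: real and x1 :: "real ^ 'd"
    and M :: "'s measure" +
  fixes n T :: nat and i :: "nat \<Rightarrow> 's \<Rightarrow> nat" and U :: "nat \<Rightarrow> 's \<Rightarrow> real ^ 'd" and \<tau> :: "'s \<Rightarrow> nat"
  assumes n: "1 \<le> n" and T: "1 \<le> T"
    and pq: "1 \<le> p" "1 \<le> q" "1 / p + 1 / q = 1"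
    and fs_differentiable: "\<And>l x. l \<in> {1..n} \<Longrightarrow> fs l differentiable (at x)"
    and L: "0 < L"
    and fs_lipschitz: "\<And>l x y. l \<in> {1..n} \<Longrightarrow>
      lr_norm p (grad (fs l) x - grad (fs l) y) \<le> L * lr_norm q (x - y)"
    and f_def: "f = (\<lambda>x. (1 / real n) * (\<Sum>l=1..n. fs l x))"
    and D: "0 \<le> D" and \<gamma>: "0 < \<gamma>"
    and sampling: "signsvrg_sampling M n T i U \<tau>"
begin

definition sample :: "'s \<Rightarrow> nat \<Rightarrow> nat \<times> (real ^ 'd)" where
  "sample \<omega> t = (i t \<omega>, U t \<omega>)"

abbreviation state :: "nat \<Rightarrow> 's \<Rightarrow> 'd triple" where
  "state m \<omega> \<equiv> run (sample \<omega>) m"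

section \<open>The averaged objective and the size of the radius\<close>

lemma GDERIV_f: "GDERIV f x :> (1 / real n) *\<^sub>R (\<Sum>l=1..n. grad (fs l) x)"
  unfolding f_def by (rule GDERIV_average) (use fs_differentiable in auto)

lemma grad_f: "grad f x = (1 / real n) *\<^sub>R (\<Sum>l=1..n. grad (fs l) x)"
  by (rule grad_eqI[OF GDERIV_f])

lemma f_differentiable: "f differentiable (at x)"
  using GDERIV_f by (auto simp: gderiv_def differentiable_def)

lemma f_lipschitz: "lr_norm p (grad f x - grad f y) \<le> L * lr_norm q (x - y)"
proof -
  have "lr_norm p (grad f x - grad f y)
      = (1 / real n) * lr_norm p (\<Sum>l=1..n. grad (fs l) x - grad (fs l) y)"
    unfolding grad_f using pq lr_norm_scaleR[of p "1 / real n"]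
    by (simp add: sum_subtractf flip: scaleR_diff_right)
  also have "\<dots> \<le> (1 / real n) * (\<Sum>l=1..n. L * lr_norm q (x - y))"
    using fs_lipschitz
    by (intro mult_left_mono order_trans[OF lr_norm_sum[OF pq(1)]] sum_mono) auto
  finally show ?thesis using n by simp
qed

lemma radius_component:
  "radius s $ j = L * lr_norm q (pos s - ref s) +
     (case v of Variant1 \<Rightarrow> lr_norm p (refgrad s) | Variant2 \<Rightarrow> \<bar>refgrad s $ j\<bar>)"
  by (simp add: radius_def smoothing_radius_def)

text \<open>This makes \<open>integral_sgn_uniform_cube\<close> applicable. The first summand of the
  radius pays for the difference of sampled gradients, the second for the reference gradient. Any
  triple is allowed, reachable or not.\<close>

lemma abs_estimate_le_radius:
  assumes "l \<in> {1..n}"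
  shows "\<bar>estimate s l $ j\<bar> \<le> radius s $ j"
proof -
  let ?d = "grad (fs l) (pos s) - grad (fs l) (ref s)"
  have "\<bar>estimate s l $ j\<bar> \<le> \<bar>?d $ j\<bar> + \<bar>refgrad s $ j\<bar>"
    by (simp add: estimate_def)
  moreover have "\<bar>?d $ j\<bar> \<le> L * lr_norm q (pos s - ref s)"
    by (rule order_trans[OF abs_component_le_lr_norm[OF pq(1)] fs_lipschitz[OF assms]])
  moreover have "\<bar>refgrad s $ j\<bar> \<le> lr_norm p (refgrad s)"
    by (rule abs_component_le_lr_norm[OF pq(1)])
  ultimately show ?thesis unfolding radius_component by (auto split: variant.split)
qed

lemma radius_nonneg: "0 \<le> radius s $ j"
  using abs_estimate_le_radius[of 1 s j] n by force

text \<open>Averaging turns the sampled differences into a difference of full gradients, whose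
  second term cancels \<open>refgrad s\<close>. For runs the hypothesis is the invariant
  \<open>refgrad_run\<close>.\<close>

lemma mean_estimate:
  assumes "refgrad s = grad f (ref s)"
  shows "(1 / real n) * (\<Sum>l=1..n. estimate s l $ j) = grad f (pos s) $ j"
proof -
  have "(1 / real n) * (\<Sum>l=1..n. estimate s l $ j)
      = grad f (pos s) $ j - grad f (ref s) $ j + refgrad s $ j"
    using n unfolding estimate_def
    by (simp add: grad_f sum.distrib sum_subtractf sum_component field_simps)
  then show ?thesis using assms by simp
qed

lemma abs_grad_le_radius:
  assumes "refgrad s = grad f (ref s)"
  shows "\<bar>grad f (pos s) $ j\<bar> \<le> radius s $ j"
proof -
  have "\<bar>\<Sum>l=1..n. estimate s l $ j\<bar> \<le> (\<Sum>l=1..n. radius s $ j)"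
    by (rule order_trans[OF sum_abs sum_mono[OF abs_estimate_le_radius]])
  then show ?thesis
    using n unfolding mean_estimate[OF assms, symmetric] by (simp add: abs_mult field_simps)
qed

section \<open>Laws of the samples and conditioning on the past\<close>

lemma distr_i: "t \<in> {1..T} \<Longrightarrow> distr M (count_space UNIV) (i t) = measure_pmf (pmf_of_set {1..n})"
    and distr_U: "t \<in> {1..T} \<Longrightarrow> distr M borel (U t) = uniform_measure lborel cube"
    and distr_\<tau>: "distr M (count_space UNIV) \<tau> = measure_pmf (pmf_of_set {1..T})"
    and indep_i_U: "t \<in> {1..T} \<Longrightarrow> indep_rv M (count_space UNIV) (i t) borel (U t)"
    and indep_samples: "indep_vars (\<lambda>_. count_space UNIV \<Otimes>\<^sub>M borel) (\<lambda>t \<omega>. sample \<omega> t) {1..T}"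
    and indep_\<tau>: "indep_rv M (count_space UNIV) \<tau> (PiM {1..T} (\<lambda>_. count_space UNIV \<Otimes>\<^sub>M borel))
      (\<lambda>\<omega>. restrict (sample \<omega>) {1..T})"
  using sampling by (auto simp: signsvrg_sampling_def cube_def sample_def[abs_def])

lemma measurable_i: "t \<in> {1..T} \<Longrightarrow> i t \<in> measurable M (count_space UNIV)"
  and measurable_U: "t \<in> {1..T} \<Longrightarrow> U t \<in> measurable M borel"
  using indep_i_U by (auto simp: indep_rv_def)

lemma measurable_\<tau>: "\<tau> \<in> measurable M (count_space UNIV)"
  using indep_\<tau> by (auto simp: indep_rv_def)

lemma measurable_sample:
  assumes "t \<in> {1..T}"
  shows "(\<lambda>\<omega>. sample \<omega> t) \<in> measurable M (count_space UNIV \<Otimes>\<^sub>M borel)"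
  using indep_samples assms by (auto simp: indep_vars_def)

lemma state_eq_run_restrict:
  assumes "{1..m} \<subseteq> I"
  shows "state m \<omega> = run (restrict (sample \<omega>) I) m"
  using assms by (intro run_cong) auto

lemma measurable_state:
  assumes "m \<le> T"
  shows "state m \<in> measurable M (count_space UNIV)"
proof -
  have "(\<lambda>\<omega>. restrict (sample \<omega>) {1..T}) \<in> measurable M (PiM {1..T} (\<lambda>_. count_space UNIV \<Otimes>\<^sub>M borel))"
    using indep_\<tau> by (auto simp: indep_rv_def)
  from measurable_compose[OF this measurable_run[of m]] show ?thesis
    using assms state_eq_run_restrict[of m "{1..T}"] by simp
qed

lemma finite_range_state: "finite (range (state m))"
  by (rule finite_subset[OF _ finite_range_run[of m]]) auto

lemma integrable_finite_range:
  fixes h :: "'a \<Rightarrow> real"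
  assumes "X \<in> measurable M (count_space UNIV)" "finite (range X)"
  shows "integrable M (\<lambda>\<omega>. h (X \<omega>))"
proof -
  have "finite (range (\<lambda>\<omega>. \<bar>h (X \<omega>)\<bar>))"
    using finite_imageI[OF assms(2), of "\<lambda>x. \<bar>h x\<bar>"] by (simp add: image_image)
  then have "\<bar>h (X \<omega>)\<bar> \<le> Max (range (\<lambda>\<omega>. \<bar>h (X \<omega>)\<bar>))" for \<omega>
    by (intro Max_ge) auto
  moreover have "(\<lambda>\<omega>. h (X \<omega>)) \<in> borel_measurable M"
    by (rule measurable_compose[OF assms(1)]) simp
  ultimately show ?thesis
    by (intro integrable_const_bound) auto
qed

lemma integrable_state:
  fixes h :: "_ \<Rightarrow> real"
  assumes "m \<le> T"
  shows "integrable M (\<lambda>\<omega>. h (state m \<omega>))"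
  by (intro integrable_finite_range measurable_state finite_range_state assms)

text \<open>Conditioning on the past in elementary form: the state after m steps depends on samples
  1 to m only and takes finitely many values, so the expectation splits over these, and in each term
  the indicator is independent of sample m + 1.\<close>

lemma expectation_freezing:
  fixes K :: "_ \<Rightarrow> nat \<times> (real ^ 'd) \<Rightarrow> real"
  assumes m: "m < T"
    and K: "\<And>s. K s \<in> borel_measurable (count_space UNIV \<Otimes>\<^sub>M borel)"
    and bounded: "\<And>s z. \<bar>K s z\<bar> \<le> B s"
  shows "integrable M (\<lambda>\<omega>. K (state m \<omega>) (sample \<omega> (Suc m)))"
    and "expectation (\<lambda>\<omega>. K (state m \<omega>) (sample \<omega> (Suc m)))
      = expectation (\<lambda>\<omega>. expectation (\<lambda>\<omega>'. K (state m \<omega>) (sample \<omega>' (Suc m))))"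
proof -
  let ?N = "\<lambda>I. PiM I (\<lambda>_. count_space UNIV \<Otimes>\<^sub>M borel) :: (nat \<Rightarrow> nat \<times> (real ^ 'd)) measure"
  let ?S = "range (state m)"
  have intK: "integrable M (\<lambda>\<omega>. K s (sample \<omega> (Suc m)))" for s
    using m bounded by (intro integrable_const_bound[where B = "B s"]
        measurable_compose[OF measurable_sample K]) auto
  have intS: "integrable M (\<lambda>\<omega>. indicator {s} (state m \<omega>) :: real)" for s
    using m by (intro integrable_state) auto
  have ind: "indep_var borel (\<lambda>\<omega>. indicator {s} (state m \<omega>) :: real)
      borel (\<lambda>\<omega>. K s (sample \<omega> (Suc m)))" for s
  proof -
    have "indep_var (?N {1..m}) (\<lambda>\<omega>. restrict (sample \<omega>) {1..m})
        (?N {Suc m}) (\<lambda>\<omega>. restrict (sample \<omega>) {Suc m})"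
      using m indep_var_restrict[OF indep_samples, of "{1..m}" "{Suc m}"] by auto
    then have "indep_var borel ((\<lambda>w. indicator {s} (run w m) :: real) \<circ> (\<lambda>\<omega>. restrict (sample \<omega>) {1..m}))
        borel ((\<lambda>w. K s (w (Suc m))) \<circ> (\<lambda>\<omega>. restrict (sample \<omega>) {Suc m}))"
    proof (rule indep_var_compose)
      show "(\<lambda>w. indicator {s} (run w m) :: real) \<in> borel_measurable (?N {1..m})"
        by (rule measurable_compose[OF measurable_run]) auto
      show "(\<lambda>w. K s (w (Suc m))) \<in> borel_measurable (?N {Suc m})"
        by (rule measurable_compose[OF _ K]) (rule measurable_component_singleton, simp)
    qed
    then show ?thesis
      by (simp add: comp_def flip: state_eq_run_restrict)
  qed
  have split: "g (state m \<omega>) = (\<Sum>s\<in>?S. indicator {s} (state m \<omega>) * g s)" for g :: "_ \<Rightarrow> real" and \<omega>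
  proof -
    have "(\<Sum>s\<in>?S. indicator {s} (state m \<omega>) * g s) = (\<Sum>s\<in>?S. if state m \<omega> = s then g s else 0)"
      by (rule sum.cong) (auto simp: indicator_def)
    then show ?thesis by (simp add: finite_range_state)
  qed
  \<comment> \<open>The summand now depends on \<omega> through the sample as well, which is
    legitimate because \<open>split\<close> holds pointwise in \<omega>.\<close>
  note splitK = split[of "\<lambda>s. K s (sample \<omega> (Suc m))" \<omega> for \<omega>]
  have prod_int: "integrable M (\<lambda>\<omega>. indicator {s} (state m \<omega>) * K s (sample \<omega> (Suc m)))" for s
    by (rule indep_var_integrable[OF ind intS intK])
  show "integrable M (\<lambda>\<omega>. K (state m \<omega>) (sample \<omega> (Suc m)))"
    by (subst splitK) (intro Bochner_Integration.integrable_sum prod_int)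
  have "expectation (\<lambda>\<omega>. K (state m \<omega>) (sample \<omega> (Suc m)))
      = (\<Sum>s\<in>?S. expectation (\<lambda>\<omega>. indicator {s} (state m \<omega>) * K s (sample \<omega> (Suc m))))"
    by (subst splitK) (intro Bochner_Integration.integral_sum prod_int)
  also have "\<dots> = (\<Sum>s\<in>?S. expectation (\<lambda>\<omega>. indicator {s} (state m \<omega>)
      * expectation (\<lambda>\<omega>'. K s (sample \<omega>' (Suc m)))))"
    by (simp add: indep_var_lebesgue_integral[OF ind intS intK])
  also have "\<dots> = expectation (\<lambda>\<omega>. expectation (\<lambda>\<omega>'. K (state m \<omega>) (sample \<omega>' (Suc m))))"
    by (subst split) (simp add: Bochner_Integration.integral_sum intS)
  finally show "expectation (\<lambda>\<omega>. K (state m \<omega>) (sample \<omega> (Suc m)))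
      = expectation (\<lambda>\<omega>. expectation (\<lambda>\<omega>'. K (state m \<omega>) (sample \<omega>' (Suc m))))" .
qed

lemma prob_i:
  assumes "t \<in> {1..T}"
  shows "expectation (\<lambda>\<omega>. indicator {l} (i t \<omega>)) = indicator {1..n} l / real n"
proof -
  have "expectation (\<lambda>\<omega>. indicator {l} (i t \<omega>) :: real)
      = integral\<^sup>L (distr M (count_space UNIV) (i t)) (indicator {l})"
    using measurable_i[OF assms] by (subst integral_distr) auto
  then show ?thesis
    using n by (simp add: distr_i[OF assms] measure_pmf_single pmf_of_set)
qed

lemma prob_\<tau>: "expectation (\<lambda>\<omega>. indicator {t} (\<tau> \<omega>)) = indicator {1..T} t / real T"
proof -
  have "expectation (\<lambda>\<omega>. indicator {t} (\<tau> \<omega>) :: real)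
      = integral\<^sup>L (distr M (count_space UNIV) \<tau>) (indicator {t})"
    using measurable_\<tau> by (subst integral_distr) auto
  then show ?thesis
    using T by (simp add: distr_\<tau> measure_pmf_single pmf_of_set)
qed

lemma AE_distr_pmf_of_set:
  assumes "X \<in> measurable M (count_space UNIV)" "finite A" "A \<noteq> {}"
    and "distr M (count_space UNIV) X = measure_pmf (pmf_of_set A)"
  shows "AE \<omega> in M. X \<omega> \<in> A"
proof -
  have "AE x in distr M (count_space UNIV) X. x \<in> A"
    unfolding assms(4) using assms(2,3) by (simp add: AE_measure_pmf_iff)
  then show ?thesis
    by (subst (asm) AE_distr_iff) (use assms(1) in auto)
qed

text \<open>The sampled index is decomposed into its values; independence separates each from the
  noise, whose integral is \<open>a l $ j / G $ j\<close>, and the uniform weights produce the mean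
  over l.\<close>

lemma expectation_sgn:
  fixes a :: "nat \<Rightarrow> real ^ 'd"
  assumes t: "t \<in> {1..T}" and a: "\<And>l. l \<in> {1..n} \<Longrightarrow> \<bar>a l $ j\<bar> \<le> G $ j"
  shows "expectation (\<lambda>\<omega>. sgn (a (i t \<omega>) $ j + G $ j * U t \<omega> $ j))
    = (1 / real n) * (\<Sum>l=1..n. a l $ j) / G $ j"
proof -
  have comp [measurable]: "(\<lambda>u :: real ^ 'd. u $ j) \<in> borel_measurable borel"
    by (intro borel_measurable_continuous_onI continuous_intros)
  note [measurable] = measurable_i[OF t] measurable_U[OF t]
  let ?h = "\<lambda>l u. sgn (a l $ j + G $ j * u $ j)"
  have h: "?h l \<in> borel_measurable borel" for l by measurable
  have inth: "integrable M (\<lambda>\<omega>. ?h l (U t \<omega>))" for l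
    by (rule integrable_const_bound[where B = 1]) (auto simp: abs_sgn_eq)
  have inti: "integrable M (\<lambda>\<omega>. indicator {l} (i t \<omega>) :: real)" for l
    by (rule integrable_const_bound[where B = 1])
      (auto intro: measurable_compose[OF measurable_i[OF t]])
  have ind: "indep_var borel (\<lambda>\<omega>. indicator {l} (i t \<omega>) :: real) borel (\<lambda>\<omega>. ?h l (U t \<omega>))" for l
    by (rule indep_rv_imp_indep_var[OF prob_space_axioms indep_i_U[OF t] _ h]) simp
  have Eh: "expectation (\<lambda>\<omega>. ?h l (U t \<omega>)) = a l $ j / G $ j" if "l \<in> {1..n}" for l
  proof -
    have "expectation (\<lambda>\<omega>. ?h l (U t \<omega>)) = integral\<^sup>L (distr M borel (U t)) (?h l)"
      by (subst integral_distr) auto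
    then show ?thesis
      using integral_sgn_uniform_cube[OF a[OF that]] by (simp add: distr_U[OF t])
  qed
  \<comment> \<open>The bound on \<open>a\<close> is available on 1..n only; the law of
    \<open>i t\<close> makes the complement a null event.\<close>
  have "AE \<omega> in M. i t \<omega> \<in> {1..n}"
    using n t by (intro AE_distr_pmf_of_set measurable_i distr_i) auto
  then have "AE \<omega> in M. ?h (i t \<omega>) (U t \<omega>) = (\<Sum>l=1..n. indicator {l} (i t \<omega>) * ?h l (U t \<omega>))"
  proof eventually_elim
    case (elim \<omega>)
    have "(\<Sum>l=1..n. indicator {l} (i t \<omega>) * ?h l (U t \<omega>))
        = (\<Sum>l=1..n. if i t \<omega> = l then ?h l (U t \<omega>) else 0)"
      by (rule sum.cong) (auto simp: indicator_def)
    then show ?case using elim by simp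
  qed
  moreover have "(\<lambda>\<omega>. ?h (i t \<omega>) (U t \<omega>)) \<in> borel_measurable M"
    by (rule measurable_compose_countable[where f = "\<lambda>l \<omega>. ?h l (U t \<omega>)" and g = "i t"]) measurable
  moreover have "(\<lambda>\<omega>. \<Sum>l=1..n. indicator {l} (i t \<omega>) * ?h l (U t \<omega>)) \<in> borel_measurable M"
    by (intro borel_measurable_sum borel_measurable_times borel_measurable_integrable inti inth)
  ultimately have "expectation (\<lambda>\<omega>. ?h (i t \<omega>) (U t \<omega>))
      = expectation (\<lambda>\<omega>. \<Sum>l=1..n. indicator {l} (i t \<omega>) * ?h l (U t \<omega>))"
    by (intro integral_cong_AE)
  also have "\<dots> = (\<Sum>l=1..n. (1 / real n) * (a l $ j / G $ j))"
    by (subst Bochner_Integration.integral_sum[OF indep_var_integrable[OF ind inti inth]])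
      (simp add: indep_var_lebesgue_integral[OF ind inti inth] prob_i[OF t] Eh)
  finally show ?thesis by (simp add: sum_distrib_left sum_divide_distrib)
qed

section \<open>Expected descent in one step\<close>

definition progress :: "'d triple \<Rightarrow> real" where
  "progress s = (\<Sum>j\<in>UNIV. (grad f (pos s) $ j)\<^sup>2 / radius s $ j)"

lemma expectation_direction:
  assumes "t \<in> {1..T}" "refgrad s = grad f (ref s)"
  shows "expectation (\<lambda>\<omega>. grad f (pos s) \<bullet> direction s (sample \<omega> t)) = progress s"
proof -
  have comp [measurable]: "(\<lambda>u :: real ^ 'd. u $ j) \<in> borel_measurable (count_space UNIV)" for j
    by simp
  have meas: "(\<lambda>\<omega>. direction s (sample \<omega> t) $ j) \<in> borel_measurable M" for j
    by (rule measurable_compose[OF measurable_compose[OF measurable_sample[OF assms(1)]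
            measurable_direction] comp])
  have "integrable M (\<lambda>\<omega>. direction s (sample \<omega> t) $ j)" for j
    by (rule integrable_const_bound[where B = 1])
      (use meas in \<open>auto simp: direction_def sign_vec_def abs_sgn_eq\<close>)
  moreover have "expectation (\<lambda>\<omega>. direction s (sample \<omega> t) $ j) = grad f (pos s) $ j / radius s $ j" for j
    using expectation_sgn[where a = "estimate s" and G = "radius s", OF assms(1) abs_estimate_le_radius,
        unfolded mean_estimate[OF assms(2)]]
    by (simp add: direction_def sign_vec_def coord_mult_def sample_def)
  ultimately show ?thesis
    by (simp add: inner_vec_def progress_def power2_eq_square)
qed

lemma measurable_inner_direction:
  "(\<lambda>z. g \<bullet> direction s z) \<in> borel_measurable (count_space UNIV \<Otimes>\<^sub>M borel)"
  by (rule measurable_compose[OF measurable_direction]) simp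

lemma abs_inner_direction_le: "\<bar>g \<bullet> direction s z\<bar> \<le> (\<Sum>j\<in>UNIV. \<bar>g $ j\<bar>)"
  unfolding inner_vec_def
  by (intro order_trans[OF sum_abs] sum_mono)
    (simp add: direction_def sign_vec_def abs_mult abs_sgn_eq)

text \<open>Bound on the quadratic term of the descent lemma: a sign vector has q-norm at most
  d^(1/q), so this holds whatever the state.\<close>

definition step_error :: real where
  "step_error = L / 2 * (\<gamma> * real CARD('d) powr real_of_ereal (1 / q))\<^sup>2"

lemma descent_step:
  "f (pos (run w (Suc m))) \<le> f (pos (run w m))
     - \<gamma> * (grad f (pos (run w m)) \<bullet> direction (run w m) (w (Suc m))) + step_error"
proof -
  let ?\<sigma> = "direction (run w m) (w (Suc m))"
  have "lr_norm q (- \<gamma> *\<^sub>R ?\<sigma>) \<le> \<gamma> * real CARD('d) powr real_of_ereal (1 / q)"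
    unfolding lr_norm_scaleR[OF pq(2)] direction_def
    using \<gamma> pq(2) by (auto intro: mult_left_mono lr_norm_sign_vec_le)
  then have "L / 2 * (lr_norm q (- \<gamma> *\<^sub>R ?\<sigma>))\<^sup>2 \<le> step_error"
    unfolding step_error_def using L by (intro mult_left_mono power_mono lr_norm_nonneg) auto
  with descent_lemma[OF pq f_differentiable _ f_lipschitz, of "pos (run w m)" "- \<gamma> *\<^sub>R ?\<sigma>"] L
  show ?thesis by (simp add: run_Suc pos_advance)
qed

lemma expected_descent_step:
  assumes m: "m < T"
  shows "expectation (\<lambda>\<omega>. f (pos (state (Suc m) \<omega>))) \<le> expectation (\<lambda>\<omega>. f (pos (state m \<omega>)))
    - \<gamma> * expectation (\<lambda>\<omega>. progress (state m \<omega>)) + step_error"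
proof -
  \<comment> \<open>Only this inner product needs averaging over the new sample; with the state
    frozen its expectation is \<open>progress\<close>, thanks to \<open>refgrad_run\<close>.\<close>
  let ?K = "\<lambda>s z. grad f (pos s) \<bullet> direction s z"
  note freeze = expectation_freezing[OF m, of ?K "\<lambda>s. \<Sum>j\<in>UNIV. \<bar>grad f (pos s) $ j\<bar>",
      OF measurable_inner_direction abs_inner_direction_le]
  have int: "integrable M (\<lambda>\<omega>. ?K (state m \<omega>) (sample \<omega> (Suc m)))"
    and E: "expectation (\<lambda>\<omega>. ?K (state m \<omega>) (sample \<omega> (Suc m)))
      = expectation (\<lambda>\<omega>. progress (state m \<omega>))"
    using freeze m by (simp_all add: expectation_direction refgrad_run)
  have intf: "integrable M (\<lambda>\<omega>. f (pos (state k \<omega>)))" if "k \<le> T" for k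
    by (rule integrable_state[OF that])
  have "expectation (\<lambda>\<omega>. f (pos (state (Suc m) \<omega>)))
      \<le> expectation (\<lambda>\<omega>. f (pos (state m \<omega>)) - \<gamma> * ?K (state m \<omega>) (sample \<omega> (Suc m)) + step_error)"
    using m by (intro integral_mono intf Bochner_Integration.integrable_add
        Bochner_Integration.integrable_diff integrable_mult_right int descent_step) auto
  also have "\<dots> = expectation (\<lambda>\<omega>. f (pos (state m \<omega>)))
      - \<gamma> * expectation (\<lambda>\<omega>. progress (state m \<omega>)) + step_error"
    using m int intf[of m] by (simp add: E prob_space)
  finally show ?thesis .
qed

section \<open>Averages over time and the randomly drawn output\<close>

definition avg :: "('d triple \<Rightarrow> real) \<Rightarrow> real" where
  "avg h = (1 / real T) * (\<Sum>m<T. expectation (\<lambda>\<omega>. h (state m \<omega>)))"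

text \<open>The comparison is demanded at states of runs only, so that invariants such as
  \<open>lr_norm_pos_ref_run\<close> are available for it.\<close>

lemma avg_mono:
  assumes "\<And>w m. h (run w m) \<le> k (run w m)"
  shows "avg h \<le> avg k"
  unfolding avg_def
  by (intro mult_left_mono sum_mono integral_mono integrable_state assms) auto

lemma avg_add: "avg (\<lambda>s. h s + k s) = avg h + avg k"
  and avg_diff: "avg (\<lambda>s. h s - k s) = avg h - avg k"
proof -
  have int: "integrable M (\<lambda>\<omega>. g (state m \<omega>))" if "m \<in> {..<T}" for g :: "_ \<Rightarrow> real" and m
    using that by (intro integrable_state) simp
  show "avg (\<lambda>s. h s + k s) = avg h + avg k" "avg (\<lambda>s. h s - k s) = avg h - avg k"
    unfolding avg_def distrib_left[symmetric] right_diff_distrib[symmetric]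
      sum.distrib[symmetric] sum_subtractf[symmetric]
    by (auto intro!: sum.cong Bochner_Integration.integral_add Bochner_Integration.integral_diff int)
qed

lemma avg_cmult: "avg (\<lambda>s. c * h s) = c * avg h"
  by (simp add: avg_def sum_distrib_left)

lemma avg_const: "avg (\<lambda>s. c) = c"
  using T by (simp add: avg_def prob_space)

lemma avg_progress_nonneg: "0 \<le> avg progress"
  using avg_mono[of "\<lambda>_. 0" progress] radius_nonneg
  by (simp add: avg_const progress_def sum_nonneg)

text \<open>Telescoping: apart from T quadratic errors, the total expected decrease cannot exceed
  the gap between the initial value and a lower bound.\<close>

lemma avg_progress_le:
  assumes "\<And>x. lb \<le> f x"
  shows "real T * \<gamma> * avg progress \<le> f x1 - lb + real T * step_error"
proof -
  have "N \<le> T \<Longrightarrow> expectation (\<lambda>\<omega>. f (pos (state N \<omega>)))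
      \<le> f x1 - \<gamma> * (\<Sum>m<N. expectation (\<lambda>\<omega>. progress (state m \<omega>))) + real N * step_error" for N
  proof (induction N)
    case 0
    then show ?case by (simp add: run_0 pos_def prob_space)
  next
    case (Suc N)
    then show ?case using expected_descent_step[of N] by (simp add: algebra_simps)
  qed
  from this[of T] have "expectation (\<lambda>\<omega>. f (pos (state T \<omega>)))
      \<le> f x1 - real T * \<gamma> * avg progress + real T * step_error"
    using T by (simp add: avg_def)
  moreover have "lb \<le> expectation (\<lambda>\<omega>. f (pos (state T \<omega>)))"
    using integral_mono[of M "\<lambda>_. lb" "\<lambda>\<omega>. f (pos (state T \<omega>))"] assms
      integrable_state[OF order_refl, of "\<lambda>s. f (pos s)"]
    by (simp add: prob_space)
  ultimately show ?thesis by simp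
qed

text \<open>
  Nothing is assumed about i and U beyond time T, so on the null event that \<open>\<tau>\<close> is not in 1..T the
  output may fail to be measurable; its Lebesgue integral is then 0.
\<close>
lemma expectation_output:
  "expectation (\<lambda>\<omega>. h (state (\<tau> \<omega> - 1) \<omega>)) \<in> {0, avg h}"
proof (cases "(\<lambda>\<omega>. h (state (\<tau> \<omega> - 1) \<omega>)) \<in> borel_measurable M")
  case False
  then show ?thesis
    using not_integrable_integral_eq borel_measurable_integrable by blast
next
  case True
  let ?N = "PiM {1..T} (\<lambda>_. count_space UNIV \<Otimes>\<^sub>M borel) :: (nat \<Rightarrow> nat \<times> (real ^ 'd)) measure"
  have inth: "integrable M (\<lambda>\<omega>. h (state (t - 1) \<omega>))" if "t \<in> {1..T}" for t
    using that by (intro integrable_state) auto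
  have int\<tau>: "integrable M (\<lambda>\<omega>. indicator {t} (\<tau> \<omega>) :: real)" for t
    by (rule integrable_const_bound[where B = 1]) (auto intro: measurable_compose[OF measurable_\<tau>])
  have ind: "indep_var borel (\<lambda>\<omega>. indicator {t} (\<tau> \<omega>) :: real) borel (\<lambda>\<omega>. h (state (t - 1) \<omega>))"
    if "t \<in> {1..T}" for t
  proof -
    have sub: "{1..t - 1} \<subseteq> {1..T}" using that by auto
    have "(\<lambda>w. h (run w (t - 1))) \<in> borel_measurable ?N"
      by (rule measurable_compose[OF measurable_run[OF sub]]) simp
    from indep_rv_imp_indep_var[OF prob_space_axioms indep_\<tau> _ this, of "indicator {t}" borel]
    show ?thesis unfolding state_eq_run_restrict[OF sub] by simp
  qed
  let ?Y = "\<lambda>\<omega>. \<Sum>t=1..T. indicator {t} (\<tau> \<omega>) * h (state (t - 1) \<omega>)"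
  have "AE \<omega> in M. \<tau> \<omega> \<in> {1..T}"
    using T by (intro AE_distr_pmf_of_set measurable_\<tau> distr_\<tau>) auto
  then have "AE \<omega> in M. h (state (\<tau> \<omega> - 1) \<omega>) = ?Y \<omega>"
  proof eventually_elim
    case (elim \<omega>)
    have "?Y \<omega> = (\<Sum>t=1..T. if \<tau> \<omega> = t then h (state (t - 1) \<omega>) else 0)"
      by (rule sum.cong) (auto simp: indicator_def)
    then show ?case using elim by simp
  qed
  moreover have "?Y \<in> borel_measurable M"
    by (intro borel_measurable_sum borel_measurable_times borel_measurable_integrable int\<tau> inth)
  ultimately have "expectation (\<lambda>\<omega>. h (state (\<tau> \<omega> - 1) \<omega>)) = expectation ?Y"
    using True by (intro integral_cong_AE)
  also have "\<dots> = (\<Sum>t=1..T. (1 / real T) * expectation (\<lambda>\<omega>. h (state (t - 1) \<omega>)))"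
  proof -
    have "expectation ?Y = (\<Sum>t=1..T. expectation (\<lambda>\<omega>. indicator {t} (\<tau> \<omega>) * h (state (t - 1) \<omega>)))"
      by (intro Bochner_Integration.integral_sum indep_var_integrable[OF ind int\<tau> inth])
    also have "\<dots> = (\<Sum>t=1..T. (1 / real T) * expectation (\<lambda>\<omega>. h (state (t - 1) \<omega>)))"
    proof (rule sum.cong[OF refl])
      fix t assume t: "t \<in> {1..T}"
      show "expectation (\<lambda>\<omega>. indicator {t} (\<tau> \<omega>) * h (state (t - 1) \<omega>))
          = (1 / real T) * expectation (\<lambda>\<omega>. h (state (t - 1) \<omega>))"
        unfolding indep_var_lebesgue_integral[OF ind[OF t] int\<tau> inth[OF t]] prob_\<tau> using t by simp
    qed
    finally show ?thesis .
  qed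
  also have "\<dots> = avg h"
    unfolding avg_def sum_distrib_left
    by (rule sum.reindex_bij_witness[of _ Suc "\<lambda>t. t - 1"]) auto
  finally show ?thesis by simp
qed

section \<open>Radius from above, progress from below, and the final estimates\<close>

lemma reference_gradient_lipschitz:
  "lr_norm p (grad f (ref (run w m)) - grad f (pos (run w m))) \<le> L * D"
  using L pq D unfolding lr_norm_minus_commute[OF pq(1), of "grad f (ref (run w m))"]
  by (intro order_trans[OF f_lipschitz] mult_left_mono lr_norm_pos_ref_run) auto

lemma radius_le_variant1:
  assumes "v = Variant1"
  shows "radius (run w m) $ j \<le> 2 * L * D + lr_norm p (grad f (pos (run w m)))"
proof -
  let ?s = "run w m"
  have "lr_norm p (grad f (ref ?s))
      \<le> lr_norm p (grad f (ref ?s) - grad f (pos ?s)) + lr_norm p (grad f (pos ?s))"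
    using lr_norm_triangle[OF pq(1), of "grad f (ref ?s) - grad f (pos ?s)" "grad f (pos ?s)"] by simp
  moreover have "L * lr_norm q (pos ?s - ref ?s) \<le> L * D"
    using L pq D by (intro mult_left_mono lr_norm_pos_ref_run) auto
  ultimately show ?thesis
    using reference_gradient_lipschitz[of w m] assms
    unfolding radius_component refgrad_run by simp
qed

lemma radius_le_variant2:
  assumes "v = Variant2"
  shows "radius (run w m) $ j \<le> 2 * L * D + \<bar>grad f (pos (run w m)) $ j\<bar>"
proof -
  let ?s = "run w m"
  have "\<bar>(grad f (ref ?s) - grad f (pos ?s)) $ j\<bar> \<le> L * D"
    by (rule order_trans[OF abs_component_le_lr_norm[OF pq(1)] reference_gradient_lipschitz])
  moreover have "L * lr_norm q (pos ?s - ref ?s) \<le> L * D"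
    using L pq D by (intro mult_left_mono lr_norm_pos_ref_run) auto
  ultimately show ?thesis
    using assms unfolding radius_component refgrad_run by simp
qed

text \<open>All coordinates share one radius \<open>R\<close>, so the progress is the squared
  Euclidean norm over \<open>R\<close>. Hence the Euclidean norm appears in the numerator for this
  variant, while the p-norm comes from the radius.\<close>

lemma progress_ge_variant1:
  assumes "v = Variant1"
  shows "2 * c * norm (grad f (pos (run w m)))
      - c\<^sup>2 * (2 * L * D + lr_norm p (grad f (pos (run w m)))) \<le> progress (run w m)"
proof -
  let ?s = "run w m"
  define R where "R = L * lr_norm q (pos ?s - ref ?s) + lr_norm p (refgrad ?s)"
  have R: "radius ?s $ j = R" for j
    using assms unfolding radius_component R_def by simp
  have "R = 0 \<Longrightarrow> norm (grad f (pos ?s)) = 0"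
    using abs_grad_le_radius[OF refgrad_run, of w m] by (simp add: R vec_eq_iff)
  moreover have "0 \<le> R" using radius_nonneg[of ?s] R by simp
  ultimately have "2 * c * norm (grad f (pos ?s)) - c\<^sup>2 * R \<le> (norm (grad f (pos ?s)))\<^sup>2 / R"
    by (intro quadratic_minorant)
  also have "\<dots> = progress ?s"
    by (simp add: progress_def R norm_vec_def L2_set_def sum_nonneg sum_divide_distrib)
  finally show ?thesis
    using mult_left_mono[OF radius_le_variant1[OF assms, of w m] zero_le_power2[of c]]
    unfolding R by linarith
qed

text \<open>The minorant is used in every coordinate with the same c; summation turns the moduli
  into the 1-norm and collects d copies of \<open>2 * L * D\<close>.\<close>

lemma progress_ge_variant2:
  assumes "v = Variant2"
  shows "2 * c * lr_norm 1 (grad f (pos (run w m)))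
      - c\<^sup>2 * (2 * real CARD('d) * L * D + lr_norm 1 (grad f (pos (run w m)))) \<le> progress (run w m)"
proof -
  let ?s = "run w m"
  let ?g = "grad f (pos ?s)"
  have "2 * c * \<bar>?g $ j\<bar> - c\<^sup>2 * (2 * L * D + \<bar>?g $ j\<bar>) \<le> (?g $ j)\<^sup>2 / radius ?s $ j" for j
  proof -
    have "2 * c * \<bar>?g $ j\<bar> - c\<^sup>2 * radius ?s $ j \<le> \<bar>?g $ j\<bar>\<^sup>2 / radius ?s $ j"
      using abs_grad_le_radius[OF refgrad_run, of w m j] radius_nonneg by (intro quadratic_minorant) auto
    then show ?thesis
      using mult_left_mono[OF radius_le_variant2[OF assms, of w m j] zero_le_power2[of c]] by simp
  qed
  then have "(\<Sum>j\<in>UNIV. 2 * c * \<bar>?g $ j\<bar> - c\<^sup>2 * (2 * L * D + \<bar>?g $ j\<bar>)) \<le> progress ?s"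
    unfolding progress_def by (rule sum_mono)
  moreover have "(\<Sum>j\<in>UNIV. 2 * c * \<bar>?g $ j\<bar> - c\<^sup>2 * (2 * L * D + \<bar>?g $ j\<bar>))
      = 2 * c * lr_norm 1 ?g - c\<^sup>2 * (2 * real CARD('d) * L * D + lr_norm 1 ?g)"
    by (simp add: lr_norm_one sum_subtractf sum.distrib algebra_simps flip: sum_distrib_left)
  ultimately show ?thesis by simp
qed

lemma avg_variant1:
  assumes "v = Variant1" "0 < 2 * L * D + avg (\<lambda>s. lr_norm p (grad f (pos s)))"
  shows "(avg (\<lambda>s. norm (grad f (pos s))))\<^sup>2
    \<le> avg progress * (2 * L * D + avg (\<lambda>s. lr_norm p (grad f (pos s))))"
proof (rule square_le_if_quadratic_minorants[OF assms(2)])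
  fix c
  have "avg (\<lambda>s. 2 * c * norm (grad f (pos s))
      - c\<^sup>2 * (2 * L * D + lr_norm p (grad f (pos s)))) \<le> avg progress"
    by (intro avg_mono progress_ge_variant1 assms)
  then show "2 * c * avg (\<lambda>s. norm (grad f (pos s)))
      - c\<^sup>2 * (2 * L * D + avg (\<lambda>s. lr_norm p (grad f (pos s)))) \<le> avg progress"
    by (simp only: avg_diff avg_add avg_cmult avg_const)
qed

lemma avg_variant2:
  assumes "v = Variant2"
    and "0 < 2 * real CARD('d) * L * D + avg (\<lambda>s. lr_norm 1 (grad f (pos s)))"
  shows "(avg (\<lambda>s. lr_norm 1 (grad f (pos s))))\<^sup>2
    \<le> avg progress * (2 * real CARD('d) * L * D + avg (\<lambda>s. lr_norm 1 (grad f (pos s))))"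
proof (rule square_le_if_quadratic_minorants[OF assms(2)])
  fix c
  have "avg (\<lambda>s. 2 * c * lr_norm 1 (grad f (pos s))
      - c\<^sup>2 * (2 * real CARD('d) * L * D + lr_norm 1 (grad f (pos s)))) \<le> avg progress"
    by (intro avg_mono progress_ge_variant2 assms)
  then show "2 * c * avg (\<lambda>s. lr_norm 1 (grad f (pos s)))
      - c\<^sup>2 * (2 * real CARD('d) * L * D + avg (\<lambda>s. lr_norm 1 (grad f (pos s)))) \<le> avg progress"
    by (simp only: avg_diff avg_add avg_cmult avg_const)
qed

lemma output_variant1:
  assumes "v = Variant1" "avg progress \<le> K"
  shows "expectation (\<lambda>\<omega>. lr_norm p (grad f (pos (state (\<tau> \<omega> - 1) \<omega>)))) \<le> 2 * L * D
    \<or> (expectation (\<lambda>\<omega>. norm (grad f (pos (state (\<tau> \<omega> - 1) \<omega>)))))\<^sup>2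
        / expectation (\<lambda>\<omega>. lr_norm p (grad f (pos (state (\<tau> \<omega> - 1) \<omega>)))) \<le> 2 * K"
    (is "?B \<le> _ \<or> ?A\<^sup>2 / ?B \<le> _")
proof (cases "?B \<le> 2 * L * D")
  case False
  have "0 \<le> 2 * L * D" using L D by simp
  with False have pos: "0 < ?B" by linarith
  define a b where "a = avg (\<lambda>s. norm (grad f (pos s)))"
    and "b = avg (\<lambda>s. lr_norm p (grad f (pos s)))"
  \<comment> \<open>Positivity of \<open>?B\<close> excludes the default value 0 of
    \<open>expectation_output\<close> for the denominator. In the numerator the default is harmless,
    since it can only lower the square.\<close>
  have A: "?A \<in> {0, a}" and B: "?B = b"
    using expectation_output[of "\<lambda>s. norm (grad f (pos s))"]
      expectation_output[of "\<lambda>s. lr_norm p (grad f (pos s))"] pos by (auto simp: a_def b_def)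
  have "a\<^sup>2 \<le> avg progress * (2 * L * D + b)"
    unfolding a_def b_def
    by (rule avg_variant1[OF assms(1)]) (use pos B \<open>0 \<le> 2 * L * D\<close> b_def in linarith)
  also have "avg progress * (2 * L * D + b) \<le> K * (b + b)"
    by (rule mult_mono) (use False B assms(2) pos \<open>0 \<le> 2 * L * D\<close> avg_progress_nonneg in linarith)+
  finally have "a\<^sup>2 \<le> 2 * K * b" by simp
  moreover have "?A\<^sup>2 \<le> a\<^sup>2" using A by auto
  ultimately show ?thesis using pos unfolding B by (simp add: field_simps)
qed simp

lemma output_variant2:
  assumes "v = Variant2" "avg progress \<le> K"
  shows "expectation (\<lambda>\<omega>. lr_norm 1 (grad f (pos (state (\<tau> \<omega> - 1) \<omega>))))
    \<le> max (2 * K) (2 * real CARD('d) * L * D)"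
    (is "?B \<le> max _ ?c")
proof (cases "?B \<le> ?c")
  case False
  have c: "0 \<le> ?c" using L D by simp
  with False have pos: "0 < ?B" by linarith
  define b where "b = avg (\<lambda>s. lr_norm 1 (grad f (pos s)))"
  have B: "?B = b"
    using expectation_output[of "\<lambda>s. lr_norm 1 (grad f (pos s))"] pos by (auto simp: b_def)
  have "b\<^sup>2 \<le> avg progress * (?c + b)"
    unfolding b_def by (rule avg_variant2[OF assms(1)]) (use pos B c b_def in linarith)
  also have "avg progress * (?c + b) \<le> K * (b + b)"
    by (rule mult_mono) (use False B assms(2) pos c avg_progress_nonneg in linarith)+
  \<comment> \<open>Numerator and denominator involve the same mean here, so a factor b cancels and
    b itself is bounded.\<close>
  finally have "b * b \<le> 2 * K * b" by (simp add: power2_eq_square)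
  then show ?thesis using pos unfolding B by simp
qed simp

end

theorem corollary1:
  fixes M :: "'s measure"
    and n T :: nat
    and p q :: ereal
    and f :: "real ^ 'd \<Rightarrow> real"
    and fs :: "nat \<Rightarrow> real ^ 'd \<Rightarrow> real"
    and Lq P D \<gamma> :: real
    and x1 xstar :: "real ^ 'd"
    and i :: "nat \<Rightarrow> 's \<Rightarrow> nat"
    and U :: "nat \<Rightarrow> 's \<Rightarrow> real ^ 'd"
    and \<tau> :: "'s \<Rightarrow> nat"
    and xbar :: "variant \<Rightarrow> 's \<Rightarrow> real ^ 'd"
  assumes "n \<ge> 1" and "T \<ge> 1"
    and "1 \<le> p" and "1 \<le> q" and "1 / p + 1 / q = 1"
    and "\<And>l. l \<in> {1..n} \<Longrightarrow> continuously_differentiable (fs l)"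
    and "Lq > 0"
    and "\<And>l x y. l \<in> {1..n} \<Longrightarrow>
           lr_norm p (grad (fs l) x - grad (fs l) y) \<le> Lq * lr_norm q (x - y)"
    and "f = (\<lambda>x. (1 / real n) * (\<Sum>l=1..n. fs l x))"
    and "bdd_below (range f)"
    and "\<And>x. f xstar \<le> f x"
    and "P > 0"
    and "D = P * sqrt (2 / (Lq * real T))"
    and "\<gamma> = 1 / (real CARD('d) powr real_of_ereal (1 / q)) * sqrt (2 / (Lq * real T))"
    and "signsvrg_sampling M n T i U \<tau>"
    and "\<And>v \<omega>. xbar v \<omega> =
           signsvrg_iterate v p q f fs Lq D \<gamma> x1 (\<lambda>t. i t \<omega>) (\<lambda>t. U t \<omega>) (\<tau> \<omega>)"
  shows "((LINT \<omega>|M. lr_norm p (grad f (xbar Variant1 \<omega>))) \<le> 2 * P * sqrt (2 * Lq / real T)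
          \<or> (LINT \<omega>|M. norm (grad f (xbar Variant1 \<omega>)))\<^sup>2
              / (LINT \<omega>|M. lr_norm p (grad f (xbar Variant1 \<omega>)))
             \<le> real CARD('d) powr real_of_ereal (1 / q) * (f x1 - f xstar + 1)
                * sqrt (2 * Lq / real T))
       \<and> (LINT \<omega>|M. lr_norm 1 (grad f (xbar Variant2 \<omega>)))
           \<le> sqrt (2 * Lq / real T)
              * max (real CARD('d) powr real_of_ereal (1 / q) * (f x1 - f xstar + 1))
                    (2 * real CARD('d) * P)"
proof -
  let ?c = "real CARD('d) powr real_of_ereal (1 / q)"
  \<comment> \<open>Half of the right-hand side in the second alternative of Variant 1, because
    \<open>output_variant1\<close> and \<open>output_variant2\<close> double it.\<close>
  define K where "K = ?c * (f x1 - f xstar + 1) * sqrt (2 * Lq / real T) / 2"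
  have T: "1 \<le> T" and L: "0 < Lq" by fact+
  have c: "0 < ?c" by simp
  have \<gamma>_eq: "\<gamma> = 1 / ?c * sqrt (2 / (Lq * real T))" by fact
  then have \<gamma>_pos: "0 < \<gamma>" using c T L by simp
  interpret prob_space M using assms(15) by (simp add: signsvrg_sampling_def)
  interpret signsvrg v p q f fs Lq D \<gamma> x1 M n T i U \<tau> for v
    by unfold_locales (use assms \<gamma>_pos in \<open>auto simp: continuously_differentiable_def\<close>)
  \<comment> \<open>The first root sits in \<gamma>, the second in \<open>K\<close>; through this
    product \<open>real T * \<gamma> * K\<close> becomes \<open>f x1 - f xstar + 1\<close>.\<close>
  have sqrt_mult: "sqrt (2 / (Lq * real T)) * sqrt (2 * Lq / real T) = 2 / real T"
  proof -
    have "2 / (Lq * real T) * (2 * Lq / real T) = (2 / real T)\<^sup>2"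
      using T L by (simp add: power2_eq_square field_simps)
    then show ?thesis by (simp only: real_sqrt_mult[symmetric]) simp
  qed
  have LD: "2 * Lq * D = 2 * P * sqrt (2 * Lq / real T)"
    using T L by (simp add: \<open>D = _\<close> real_sqrt_divide real_sqrt_mult field_simps)
  \<comment> \<open>The scale of \<gamma> serves this: the square in \<open>step_error\<close> is
    \<open>2 / (Lq * real T)\<close>, so each step errs by \<open>1 / real T\<close>, and the total
    is the \<open>+ 1\<close> next to \<open>f x1 - f xstar\<close>.\<close>
  have error: "real T * step_error = 1"
    unfolding step_error_def using T L c by (simp add: \<gamma>_eq power_divide)
  have "avg v (progress v) \<le> K" for v
  proof -
    have "real T * \<gamma> * avg v (progress v) \<le> f x1 - f xstar + 1"
      using avg_progress_le[of "f xstar" v] assms(11) error by simp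
    also have "\<dots> = real T * \<gamma> * K"
    proof -
      have "real T * \<gamma> * K = real T * (f x1 - f xstar + 1) / 2
          * (sqrt (2 / (Lq * real T)) * sqrt (2 * Lq / real T))"
        using c by (simp add: \<gamma>_eq K_def)
      then show ?thesis unfolding sqrt_mult using T by simp
    qed
    finally show ?thesis using T \<gamma>_pos by simp
  qed
  note output1 = output_variant1[OF refl this] and output2 = output_variant2[OF refl this]
  have xbar: "xbar v \<omega> = pos (state v (\<tau> \<omega> - 1) \<omega>)" for v \<omega>
    by (simp add: assms(16) signsvrg_iterate_def run_def sample_def pos_def)
  have max: "max (2 * K) (2 * real CARD('d) * Lq * D)
      = sqrt (2 * Lq / real T) * max (?c * (f x1 - f xstar + 1)) (2 * real CARD('d) * P)"
  proof -
    have "2 * real CARD('d) * Lq * D = sqrt (2 * Lq / real T) * (2 * real CARD('d) * P)"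
      using LD by (simp add: mult.assoc mult.left_commute)
    moreover have "2 * K = sqrt (2 * Lq / real T) * (?c * (f x1 - f xstar + 1))"
      by (simp add: K_def)
    moreover have "0 \<le> sqrt (2 * Lq / real T)" using L by simp
    ultimately show ?thesis by (simp only: max_mult_distrib_left if_True)
  qed
  show ?thesis
    using output1 output2 unfolding xbar max
    by (simp add: LD K_def)
qed

end
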